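(* Let $\lambda=-\sqrt2$. For $z\in[0,1)^2$ the minimal period length $\pi(z)$ is: \begin{itemize} \item $1$ if $z\in\{(0,0),(1-1/\sqrt2,1-1/\sqrt2),(2-\sqrt2,2-\sqrt2)\}$; \item $4$ if $z=T^m(3/2-\sqrt2,3/2-\sqrt2)$ for some $m\in\{0,1,2,3\}$; \item $10$ if $z=T^m(1/\sqrt2,0)$ for some $m\in\{0,1,\ldots,9\}$; \item $8$ for the other points in $\mathcal R$; \item $2\cdot3^{n+1}-5(-1)^n$ if $S^nR(z)=(3-3/\sqrt2,3-3/\sqrt2)$ for some $n\ge0$; \item $8(2\cdot3^{n+1}-5(-1)^n)$ for the other points with $S^nR(z)\in D_\alpha$, $n\ge0$; \item $4(3^{n+2}+5-5(-1)^n)$ if $S^nR(z)=\hat T^m\left((9-5\sqrt2)/2,5-3\sqrt2\right)$ for some $m\in\{0,\ldots,5\}$, $n\ge0$; \item $8(3^{n+2}+5-5(-1)^n)$ for the other points with $S^nR(z)\in\hat T^m(D_\beta)$, $m\in\{0,\ldots,5\}$, $n\ge0$; \item $2\cdot3^{n+2}+20-5(-1)^n$ if $S^nR(z)=\hat T^m(8-5\sqrt2,8-5\sqrt2)$ for some $m\in\{0,1,2\}$, $n\ge0$; \item $\infty$ if $S^nR(z)\in\mathcal D\setminus\mathcal P$ for all $n\ge0$. \end{itemize}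
   Context: $T:[0,1)^2\to[0,1)^2$ is the bijection $T(x,y)=(y,\{-x-\sqrt2y\})$ ($\{\cdot\}$ applied to a real number is the fractional part), i.e. $T(x,y)=(x,y)A+(0,\lceil x+\sqrt2y\rceil)$ with $A=\begin{pmatrix}0&-1\\1&-\sqrt2\end{pmatrix}$ (row vectors). $\pi(z)$ is the least $p\ge1$ with $T^p(z)=z$, and $\infty$ if none exists. $\mathcal D=\{(x,y)\in[0,1)^2:\ \sqrt2x+y>2\text{ or }x+\sqrt2y>2\}$; $\mathcal R=\{z\in[0,1)^2:T^m(z)\notin\mathcal D\text{ for all }m\ge0\}$. For $z\notin\mathcal R$, $R(z)=T^{r(z)}(z)$ with $r(z)=\min\{m\ge0:T^m(z)\in\mathcal D\}$. $\hat T:\mathcal D\to\mathcal D$ is the first return map of $T$ to $\mathcal D$, $\hat T(z)=R(T(z))$ (a bijection). $D_\alpha=\{z\in[0,1)^2:T^{k+1}(z)=T^k(z)A+(0,3)\text{ for all }k\in\mathbb Z\}$, $D_\beta=\{(x,2-\sqrt2x):5-3\sqrt2<x<2\sqrt2-2\}$. $U(z)=(\sqrt2-1)z+(2-\sqrt2,2-\sqrt2)$, and $\mathcal P=\{z\in\mathcal D:\hat T^m(z)\notin U(\mathcal D)\text{ for all }m\in\mathbb Z\}$. For $z\in\mathcal D\setminus\mathcal P$ fix $\hat s(z)$ as either $\min\{m\ge0:\hat T^m(z)\in U(\mathcal D)\}$ or $\max\{m\le0:\hat T^m(z)\in U(\mathcal D)\}$ (one that exists), and let $S(z)=U^{-1}\hat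 T^{\hat s(z)}(z)$, $S:\mathcal D\setminus\mathcal P\to\mathcal D$. For $z\notin\mathcal R$: $S^0R(z)=R(z)$, and $S^nR(z)=S(S^{n-1}R(z))$ is defined as long as $S^{n-1}R(z)$ is defined and in $\mathcal D\setminus\mathcal P$. Conditions on $S^nR(z)$ include that $z\notin\mathcal R$ and that it is defined. *)

theory Defs
  imports "HOL-Analysis.Analysis" "HOL-Library.Extended_Nat"
begin

definition unit_sq :: "(real \<times> real) set" where
  "unit_sq = {0..<1} \<times> {0..<1}"

text \<open>Row vector \<open>(x, y)\<close> times the matrix with rows \<open>(0, -1)\<close> and \<open>(1, -sqrt 2)\<close>.\<close>

definition timesA :: "real \<times> real \<Rightarrow> real \<times> real" where
  "timesA = (\<lambda>(x, y). (x * 0 + y * 1, x * (-1) + y * (- sqrt 2)))"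

text \<open>Only the restriction of \<open>Tmap\<close> to \<open>unit_sq\<close>, where it is bijective, is meaningful.\<close>

definition Tmap :: "real \<times> real \<Rightarrow> real \<times> real" where
  "Tmap = (\<lambda>(x, y). (y, frac (- x - sqrt 2 * y)))"

lemma Tmap_eq_timesA: "Tmap (x, y) = timesA (x, y) + (0, of_int \<lceil>x + sqrt 2 * y\<rceil>)"
proof -
  have "- x - sqrt 2 * y = - (x + sqrt 2 * y)" by simp
  then have "frac (- x - sqrt 2 * y) = - x - sqrt 2 * y + of_int \<lceil>x + sqrt 2 * y\<rceil>"
    unfolding frac_def ceiling_def by simp
  then show ?thesis by (simp add: Tmap_def timesA_def)
qed

lemma bij_betw_Tmap: "bij_betw Tmap unit_sq unit_sq"
proof (rule bij_betwI[where g = "\<lambda>(x, y). (frac (- y - sqrt 2 * x), x)"])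
  have frac_aux: "frac (- frac u - v) = w" if "u = - w - v" "0 \<le> w" "w < 1" for u v w :: real
  proof -
    have "- frac u - v = w + of_int \<lfloor>u\<rfloor>" using that by (simp add: frac_def)
    then show ?thesis using that by (simp add: frac_def floor_eq_iff)
  qed
  show "Tmap \<in> unit_sq \<rightarrow> unit_sq"
    by (auto simp: Tmap_def unit_sq_def frac_lt_1)
  show "(\<lambda>(x, y). (frac (- y - sqrt 2 * x), x)) \<in> unit_sq \<rightarrow> unit_sq"
    by (auto simp: unit_sq_def frac_lt_1)
  show "(\<lambda>(x, y). (frac (- y - sqrt 2 * x), x)) (Tmap z) = z" if "z \<in> unit_sq" for z
    using that by (auto simp: Tmap_def unit_sq_def intro!: frac_aux)
  show "Tmap ((\<lambda>(x, y). (frac (- y - sqrt 2 * x), x)) z) = z" if "z \<in> unit_sq" for z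
    using that by (auto simp: Tmap_def unit_sq_def intro!: frac_aux)
qed

text \<open>The \<open>k\<close>-th iterate, \<open>k\<close> possibly negative, of a bijection \<open>f\<close> of \<open>X\<close>.\<close>

definition int_iter :: "'a set \<Rightarrow> ('a \<Rightarrow> 'a) \<Rightarrow> int \<Rightarrow> 'a \<Rightarrow> 'a" where
  "int_iter X f k = (if 0 \<le> k then f ^^ nat k else inv_into X f ^^ nat (- k))"

definition period :: "real \<times> real \<Rightarrow> enat" where
  "period z = (if \<exists>p\<ge>1. (Tmap ^^ p) z = z
     then enat (LEAST p. 1 \<le> p \<and> (Tmap ^^ p) z = z) else \<infinity>)"

definition Dset :: "(real \<times> real) set" where
  "Dset = {(x, y) \<in> unit_sq. sqrt 2 * x + y > 2 \<or> x + sqrt 2 * y > 2}"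

definition Rset :: "(real \<times> real) set" where
  "Rset = {z \<in> unit_sq. \<forall>m. (Tmap ^^ m) z \<notin> Dset}"

text \<open>Meaningful on \<open>unit_sq - Rset\<close> only.\<close>

definition Rmap :: "real \<times> real \<Rightarrow> real \<times> real" where
  "Rmap z = (Tmap ^^ (LEAST m. (Tmap ^^ m) z \<in> Dset)) z"

text \<open>The first return map to \<open>Dset\<close>, meaningful on \<open>Dset\<close> only, which it permutes.\<close>

definition That :: "real \<times> real \<Rightarrow> real \<times> real" where
  "That z = Rmap (Tmap z)"

definition Dalpha :: "(real \<times> real) set" where
  "Dalpha = {z \<in> unit_sq. \<forall>k. int_iter unit_sq Tmap (k + 1) z
      = timesA (int_iter unit_sq Tmap k z) + (0, 3)}"

definition Dbeta :: "(real \<times> real) set" where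
  "Dbeta = {(x, 2 - sqrt 2 * x) | x. 5 - 3 * sqrt 2 < x \<and> x < 2 * sqrt 2 - 2}"

definition Umap :: "real \<times> real \<Rightarrow> real \<times> real" where
  "Umap z = (sqrt 2 - 1) *\<^sub>R z + (2 - sqrt 2, 2 - sqrt 2)"

definition Pset :: "(real \<times> real) set" where
  "Pset = {z \<in> Dset. \<forall>m. int_iter Dset That m z \<notin> Umap ` Dset}"

text \<open>\<open>s\<close> is one of the admissible choices of the hitting time function: for every
  \<open>z \<in> Dset - Pset\<close>, separately, it selects either the least nonnegative or the greatest
  nonpositive hitting time of \<open>Umap ` Dset\<close>.\<close>

definition admissible :: "(real \<times> real \<Rightarrow> int) \<Rightarrow> bool" where
  "admissible s \<longleftrightarrow> (\<forall>z \<in> Dset - Pset.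
     int_iter Dset That (s z) z \<in> Umap ` Dset \<and>
     (0 \<le> s z \<and> (\<forall>m. 0 \<le> m \<and> m < s z \<longrightarrow> int_iter Dset That m z \<notin> Umap ` Dset) \<or>
      s z \<le> 0 \<and> (\<forall>m. s z < m \<and> m \<le> 0 \<longrightarrow> int_iter Dset That m z \<notin> Umap ` Dset)))"

definition Smap :: "(real \<times> real \<Rightarrow> int) \<Rightarrow> real \<times> real \<Rightarrow> real \<times> real" where
  "Smap s z = inv Umap (int_iter Dset That (s z) z)"

text \<open>\<open>SnR s n z\<close> is \<open>None\<close> where the \<open>n\<close>-th \<open>S\<close>-iterate of \<open>Rmap z\<close> is undefined.\<close>

fun SnR :: "(real \<times> real \<Rightarrow> int) \<Rightarrow> nat \<Rightarrow> real \<times> real \<Rightarrow> (real \<times> real) option" where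
  "SnR s 0 z = (if z \<in> unit_sq - Rset then Some (Rmap z) else None)"
| "SnR s (Suc n) z = (case SnR s n z of
      None \<Rightarrow> None
    | Some w \<Rightarrow> if w \<in> Dset - Pset then Some (Smap s w) else None)"

end

theory Submission
  imports Defs "HOL-Computational_Algebra.Primes"
begin

text \<open>Up to a linear change of coordinates, \<open>Tmap\<close> is a piecewise rotation by an angle of order 8; the
  theorem holds because its first return map to \<open>Dset\<close> is self-similar.

  The line \<open>x + sqrt 2 * y = 2\<close> divides \<open>Dset\<close> into the points above it, on it and below it, and the
  first return map \<open>That\<close> is affine on each of the three parts, with the return times 1, 31 and 21
  (\<open>first_return\<close>).  The exchange of coordinates conjugates \<open>That\<close> to its inverse.  Let \<open>Vmap\<close> be the
  contraction \<open>Umap\<close> composed with this exchange.  The first return map of \<open>That\<close> to \<open>Vmap ` Dset\<close> is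
  the conjugate of \<open>That\<close> by \<open>Vmap\<close>; every return takes three steps, which start above the line, on the
  side opposite to that of the original point, and above the line again (\<open>renormalization\<close>).  So the
  times \<open>a\<^sub>n, b\<^sub>n, c\<^sub>n\<close> that \<open>Tmap\<close> needs for one step above, below and on the line in the \<open>n\<close> times
  contracted copy of \<open>Dset\<close> satisfy \<open>a\<^sub>n\<^sub>+\<^sub>1 = 2 a\<^sub>n + b\<^sub>n\<close>, \<open>b\<^sub>n\<^sub>+\<^sub>1 = 3 a\<^sub>n\<close> and \<open>c\<^sub>n\<^sub>+\<^sub>1 = 2 a\<^sub>n + c\<^sub>n\<close>, which gives
  the powers of \<open>3\<close> and \<open>-1\<close> in the periods (\<open>level_time\<close>).

  The map \<open>S\<close> undoes one contraction.  Whichever hitting time it uses, it stays on the same orbit of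
  \<open>That\<close> up to an exchange of coordinates, and an orbit and its mirror image have the same length.
  Hence the period of \<open>z\<close> is the sum of the times of level \<open>n\<close> over the \<open>That\<close>-cycle of \<open>S\<^sup>n R(z)\<close>
  (\<open>SnR_weight\<close>).  If the renormalization never stops, a finite orbit would have a number of points in
  \<open>Dset\<close> that is divisible by every power of three (\<open>period_infinite\<close>).  It stops at
  the points whose orbit avoids the contracted copy.  Such an orbit contains no point below the line.
  Either it stays above the line, which means \<open>Dalpha\<close>, or it meets the line; then the step from
  the line leads to \<open>Dbeta\<close>, whose cycles consist of blocks of five steps above the line and one on it,
  or to one single cycle of two steps above and one on the line (\<open>Pset_subset\<close>).

  The orbits that avoid \<open>Dset\<close> are found by symbolic dynamics: apart from the origin, \<open>Tmap\<close> only adds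
  the integers 1 and 2 along them, and a dozen of forbidden words leaves only the words that
  are eventually constant or eventually repeat \<open>1122\<close> or \<open>1111122222\<close> (\<open>coded_tail\<close>).  The first two
  kinds belong to points whose period divides 8, because the linear part has order 8 and the word has a
  period dividing 4; the third kind belongs to a single orbit, of length 10.\<close>

section \<open>Weights of orbits\<close>

definition orb :: "('a \<Rightarrow> 'a) \<Rightarrow> 'a \<Rightarrow> 'a set" where
  "orb f x = range (\<lambda>n. (f ^^ n) x)"

text \<open>With the weight \<open>1\<close> this is the minimal period of \<open>x\<close>, for injective \<open>f\<close>.  Counting with
  weights is what makes the period computable through induced maps: inducing on a subset leaves the
  weight of an orbit unchanged if every point of the subset collects the weights of its excursion.\<close>

definition orb_weight :: "('a \<Rightarrow> 'a) \<Rightarrow> ('a \<Rightarrow> nat) \<Rightarrow> 'a \<Rightarrow> enat" where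
  "orb_weight f h x = (if finite (orb f x) then enat (sum h (orb f x)) else \<infinity>)"

lemma funpow_gcd_fixed:
  assumes "(f ^^ a) x = x" "(f ^^ b) x = x"
  shows "(f ^^ gcd a b) x = x"
  using assms
proof (induction a b rule: gcd_nat_induct)
  case (step m n)
  have "(f ^^ (m mod n)) x = x"
    using funpow_mod_eq[OF step.prems(2), of m] step.prems(1) by (rule trans)
  then have "(f ^^ gcd n (m mod n)) x = x"
    by (intro step.IH step.prems(2))
  then show ?case
    unfolding gcd_red_nat[of m n] .
qed simp

text \<open>A divisor of \<open>p\<close> other than \<open>p\<close> divides \<open>p div q\<close> for some prime \<open>q\<close>.\<close>

lemma minimal_period_criterion:
  assumes "(f ^^ p) x = x" "p > 0"
    and prime_div: "\<And>q. prime q \<Longrightarrow> q dvd p \<Longrightarrow> (f ^^ (p div q)) x \<noteq> x"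
    and "0 < d" "d < p"
  shows "(f ^^ d) x \<noteq> x"
proof
  assume "(f ^^ d) x = x"
  define e where "e = gcd d p"
  have e: "(f ^^ e) x = x" "e dvd p" "e \<le> d"
    using funpow_gcd_fixed[OF \<open>(f ^^ d) x = x\<close> assms(1)] assms by (auto simp: e_def gcd_le1_nat)
  then obtain c where c: "p = e * c" by blast
  with e assms have "c \<noteq> 1" "c \<noteq> 0" by auto
  then obtain q where q: "prime q" "q dvd c"
    using prime_factor_nat by blast
  then obtain b where b: "c = q * b" by blast
  have "p div q = b * e"
    using c b q by (simp add: prime_gt_0_nat)
  then have "(f ^^ (p div q)) x = ((f ^^ e) ^^ b) x"
    by (simp add: funpow_mult mult.commute)
  also have "\<dots> = x"
    using e by (induction b) auto
  finally show False
    using prime_div q c by simp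
qed

locale inj_self_map =
  fixes X :: "'a set" and f :: "'a \<Rightarrow> 'a"
  assumes inj: "inj_on f X" and maps: "x \<in> X \<Longrightarrow> f x \<in> X"
begin

lemma funpow_in: "x \<in> X \<Longrightarrow> (f ^^ n) x \<in> X"
  by (induction n) (auto simp: maps)

lemma funpow_inj: "x \<in> X \<Longrightarrow> y \<in> X \<Longrightarrow> (f ^^ n) x = (f ^^ n) y \<Longrightarrow> x = y"
proof (induction n)
  case (Suc n)
  then show ?case
    using inj funpow_in by (auto dest: inj_onD)
qed simp

lemma funpow_cancel:
  assumes "x \<in> X" "y \<in> X" "i \<le> j" "(f ^^ i) x = (f ^^ j) y"
  shows "x = (f ^^ (j - i)) y"
proof -
  have "(f ^^ j) y = (f ^^ i) ((f ^^ (j - i)) y)"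
    using funpow_add[of i "j - i" f] assms(3) by simp
  with assms show ?thesis
    using funpow_inj[of x "(f ^^ (j - i)) y" i] funpow_in by auto
qed

lemma recurrent_if_finite_orb:
  assumes "x \<in> X" "finite (orb f x)"
  obtains p where "p > 0" "(f ^^ p) x = x"
proof -
  have "\<not> inj (\<lambda>n. (f ^^ n) x)"
    using assms(2) unfolding orb_def by (metis infinite_UNIV_nat finite_imageD)
  then obtain i j where "(f ^^ i) x = (f ^^ j) x" "i < j"
    unfolding inj_def by (metis linorder_neqE_nat)
  with that[of "j - i"] show ?thesis
    using funpow_cancel[of x x i j] assms by auto
qed

lemma orb_periodic:
  assumes "(f ^^ p) x = x" "p > 0"
  shows "orb f x = (\<lambda>j. (f ^^ j) x) ` {..<p}"
proof -
  have "(f ^^ n) x \<in> (\<lambda>j. (f ^^ j) x) ` {..<p}" for n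
    using assms by (intro image_eqI[of _ _ "n mod p"]) (auto simp: funpow_mod_eq)
  then show ?thesis
    by (auto simp: orb_def)
qed

lemma periodic_pull_back:
  assumes "x \<in> X" "y \<in> X" "(f ^^ n) x = y" "(f ^^ p) y = y" "p > 0"
  obtains m where "x = (f ^^ m) y"
proof -
  have "(f ^^ (p * n)) y = y"
    using assms(4) by (induction n) (auto simp: funpow_add)
  moreover have "p * n = n + (p - 1) * n"
    using assms(5) by (cases p) auto
  ultimately have "(f ^^ n) ((f ^^ ((p - 1) * n)) y) = (f ^^ n) x"
    using assms(3) by (simp add: funpow_add)
  then show ?thesis
    using that funpow_inj[of x "(f ^^ ((p - 1) * n)) y" n] funpow_in assms(1,2) by metis
qed

lemma orb_step: "orb f x = insert x (orb f (f x))"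
proof -
  have "(f ^^ n) x \<in> insert x (orb f (f x))" for n
    by (cases n) (auto simp: orb_def funpow_swap1)
  moreover have "(f ^^ n) (f x) \<in> orb f x" for n
    unfolding orb_def by (rule range_eqI[of _ _ "Suc n"]) (simp add: funpow_swap1)
  moreover have "x \<in> orb f x"
    unfolding orb_def by (rule range_eqI[of _ _ 0]) simp
  ultimately show ?thesis
    by (auto simp: orb_def[of f "f x"] orb_def[of f x])
qed

lemma orb_weight_step:
  assumes "x \<in> X"
  shows "orb_weight f h (f x) = orb_weight f h x"
proof (cases "finite (orb f x)")
  case True
  then obtain p where p: "p > 0" "(f ^^ p) x = x"
    using recurrent_if_finite_orb assms by blast
  then have "(f ^^ (p - 1)) (f x) = x"
    by (cases p) (auto simp: funpow_swap1)
  then have "x \<in> orb f (f x)"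
    unfolding orb_def by (metis rangeI)
  then have "orb f (f x) = orb f x"
    using orb_step[of x] by (simp add: insert_absorb)
  then show ?thesis
    by (simp add: orb_weight_def)
next
  case False
  then show ?thesis
    using orb_step[of x] by (simp add: orb_weight_def)
qed

lemma orb_weight_funpow: "x \<in> X \<Longrightarrow> orb_weight f h ((f ^^ n) x) = orb_weight f h x"
  by (induction n) (auto simp: orb_weight_step funpow_in)

lemma orb_weight_periodic:
  assumes "x \<in> X" "(f ^^ p) x = x" "p > 0" "\<And>d. 0 < d \<Longrightarrow> d < p \<Longrightarrow> (f ^^ d) x \<noteq> x"
  shows "orb_weight f h x = enat (\<Sum>j<p. h ((f ^^ j) x))"
proof -
  have "i = j" if "(f ^^ i) x = (f ^^ j) x" "i \<le> j" "j < p" for i j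
    using assms(4)[of "j - i"] funpow_cancel[of x x i j] that assms(1) by force
  then have "inj_on (\<lambda>j. (f ^^ j) x) {..<p}"
    by (smt (verit) inj_onI lessThan_iff nat_le_linear)
  then show ?thesis
    using orb_periodic[OF assms(2,3)] by (simp add: orb_weight_def sum.reindex)
qed

text \<open>Kac towers: the orbit of \<open>V y\<close> is the disjoint union of the excursions
  \<open>{f\<^sup>j (V u) | j < \<rho> u}\<close> over the points \<open>u\<close> of the orbit of \<open>y\<close>.  They cover the orbit because
  \<open>V\<close> conjugates \<open>g\<close> to the return map to \<open>V ` Y\<close>, and are disjoint because an equation
  \<open>f\<^sup>i (V u) = f\<^sup>j (V u')\<close> with \<open>i < j < \<rho> u'\<close> would be a return to \<open>V ` Y\<close> at the time \<open>j - i\<close>.\<close>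

lemma orb_weight_tower:
  assumes Y: "y \<in> Y" and V: "inj_on V Y" "V ` Y \<subseteq> X" and g: "\<And>u. u \<in> Y \<Longrightarrow> g u \<in> Y"
    and pos: "\<And>u. u \<in> Y \<Longrightarrow> \<rho> u > 0"
    and return: "\<And>u. u \<in> Y \<Longrightarrow> (f ^^ \<rho> u) (V u) = V (g u)"
    and first: "\<And>u j. u \<in> Y \<Longrightarrow> 0 < j \<Longrightarrow> j < \<rho> u \<Longrightarrow> (f ^^ j) (V u) \<notin> V ` Y"
  shows "orb_weight f h (V y) = orb_weight g (\<lambda>u. \<Sum>j<\<rho> u. h ((f ^^ j) (V u))) y"
proof -
  define Z where "Z = (SIGMA u:orb g y. {..<\<rho> u})"
  define \<Phi> where "\<Phi> = (\<lambda>(u, j). (f ^^ j) (V u))"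
  have orb_Y: "u \<in> Y" if "u \<in> orb g y" for u
  proof -
    have "(g ^^ n) y \<in> Y" for n
      by (induction n) (auto simp: Y g)
    with that show ?thesis by (auto simp: orb_def)
  qed
  have "(f ^^ n) (V y) \<in> \<Phi> ` Z" for n
  proof (induction n)
    case 0
    have "y \<in> orb g y"
      unfolding orb_def by (rule range_eqI[of _ _ 0]) simp
    then show ?case
      using pos[OF Y] by (auto simp: \<Phi>_def Z_def intro!: image_eqI[of _ _ "(y, 0)"])
  next
    case (Suc n)
    then obtain u j where u: "u \<in> orb g y" "j < \<rho> u" "(f ^^ n) (V y) = (f ^^ j) (V u)"
      by (auto simp: \<Phi>_def Z_def)
    then have gu: "g u \<in> orb g y"
      by (auto simp: orb_def intro: range_eqI[of _ _ "Suc k" for k])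
    show ?case
    proof (cases "Suc j < \<rho> u")
      case True
      with u show ?thesis
        by (auto simp: \<Phi>_def Z_def intro!: image_eqI[of _ _ "(u, Suc j)"])
    next
      case False
      with u have "\<rho> u = Suc j" by simp
      then have "(f ^^ Suc n) (V y) = V (g u)"
        using return[OF orb_Y[OF u(1)]] u by simp
      then show ?thesis
        using gu pos[OF orb_Y[OF gu]]
        by (auto simp: \<Phi>_def Z_def intro!: image_eqI[of _ _ "(g u, 0)"])
    qed
  qed
  moreover have "(f ^^ j) (V u) \<in> orb f (V y)" if "u \<in> orb g y" for u j
  proof -
    have "\<exists>N. (f ^^ N) (V y) = V ((g ^^ n) y)" for n
    proof (induction n)
      case 0
      show ?case by (rule exI[of _ 0]) simp
    next
      case (Suc n)
      then obtain N where "(f ^^ N) (V y) = V ((g ^^ n) y)" by blast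
      moreover have "(g ^^ n) y \<in> Y"
        by (rule orb_Y) (simp add: orb_def)
      ultimately have "(f ^^ (\<rho> ((g ^^ n) y) + N)) (V y) = V ((g ^^ Suc n) y)"
        by (simp add: funpow_add return)
      then show ?case by blast
    qed
    moreover from that obtain n where "u = (g ^^ n) y"
      by (auto simp: orb_def)
    ultimately obtain N where "(f ^^ N) (V y) = V u" by blast
    then have "(f ^^ j) (V u) = (f ^^ (j + N)) (V y)"
      by (simp add: funpow_add)
    then show ?thesis
      by (auto simp: orb_def)
  qed
  ultimately have orb_eq: "orb f (V y) = \<Phi> ` Z"
    by (fastforce simp: orb_def[of f] \<Phi>_def Z_def)
  have same: "u = u' \<and> i = j"
    if "u \<in> orb g y" "u' \<in> orb g y" "i \<le> j" "j < \<rho> u'" "(f ^^ i) (V u) = (f ^^ j) (V u')" for u u' i j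
  proof -
    have "u \<in> Y" "u' \<in> Y"
      using that orb_Y by auto
    then have eq: "V u = (f ^^ (j - i)) (V u')"
      using funpow_cancel[of "V u" "V u'" i j] that V by auto
    then have "j - i = 0"
      using first[of u' "j - i"] \<open>u \<in> Y\<close> \<open>u' \<in> Y\<close> that by force
    with eq that show ?thesis
      using V \<open>u \<in> Y\<close> \<open>u' \<in> Y\<close> by (auto dest: inj_onD)
  qed
  have inj_\<Phi>: "inj_on \<Phi> Z"
  proof (rule inj_onI; clarsimp simp: Z_def \<Phi>_def)
    fix u i u' j
    assume "u \<in> orb g y" "i < \<rho> u" "u' \<in> orb g y" "j < \<rho> u'" "(f ^^ i) (V u) = (f ^^ j) (V u')"
    then show "u = u' \<and> i = j"
      using same[of u u' i j] same[of u' u j i] by (cases "i \<le> j") auto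
  qed
  have "orb g y = fst ` Z"
    using pos orb_Y by (force simp: Z_def)
  then have fin: "finite Z \<longleftrightarrow> finite (orb g y)"
    by (metis Z_def finite_SigmaI finite_imageI finite_lessThan)
  show ?thesis
  proof (cases "finite (orb g y)")
    case True
    have "sum h (\<Phi> ` Z) = (\<Sum>(u, j)\<in>Z. h ((f ^^ j) (V u)))"
      using sum.reindex[OF inj_\<Phi>, of h] by (simp add: \<Phi>_def case_prod_unfold comp_def)
    also have "\<dots> = (\<Sum>u\<in>orb g y. \<Sum>j<\<rho> u. h ((f ^^ j) (V u)))"
      unfolding Z_def using True by (subst sum.Sigma) auto
    finally show ?thesis
      using True fin by (simp add: orb_weight_def orb_eq)
  next
    case False
    then show ?thesis
      using fin inj_\<Phi> by (simp add: orb_weight_def orb_eq finite_image_iff)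
  qed
qed

text \<open>If \<open>\<sigma>\<close> conjugates \<open>f\<close> to its inverse then it maps orbits onto orbits.  The weight \<open>h\<close> is
  attached to the step from \<open>y\<close> to \<open>f y\<close>; the assumption on \<open>h\<close> says that the reversed step, from
  \<open>\<sigma> (f y)\<close> to \<open>\<sigma> y\<close>, has the same weight.\<close>

lemma orb_weight_reversed:
  assumes x: "x \<in> X" and \<sigma>: "\<And>y. y \<in> X \<Longrightarrow> \<sigma> y \<in> X" "\<And>y. y \<in> X \<Longrightarrow> \<sigma> (\<sigma> y) = y"
    and reversed: "\<And>y. y \<in> X \<Longrightarrow> f (\<sigma> (f y)) = \<sigma> y"
    and h: "\<And>y. y \<in> X \<Longrightarrow> h (\<sigma> (f y)) = h y"
  shows "orb_weight f h (\<sigma> x) = orb_weight f h x"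
proof -
  have orb_sub: "orb f (\<sigma> y) \<subseteq> \<sigma> ` orb f y" if y: "y \<in> X" and fin: "finite (orb f y)" for y
  proof -
    obtain p where p: "p > 0" "(f ^^ p) y = y"
      using recurrent_if_finite_orb y fin by blast
    have rewind: "(f ^^ j) (\<sigma> ((f ^^ j) u)) = \<sigma> u" if "u \<in> X" for j u
      using that
    proof (induction j arbitrary: u)
      case (Suc j)
      then have "(f ^^ Suc j) (\<sigma> ((f ^^ Suc j) u)) = f ((f ^^ j) (\<sigma> ((f ^^ j) (f u))))"
        by (simp add: funpow_swap1)
      then show ?case
        using Suc maps reversed by simp
    qed simp
    have "(f ^^ j) (\<sigma> y) \<in> \<sigma> ` orb f y" for j
    proof -
      obtain m where "y = (f ^^ m) ((f ^^ j) y)"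
        using periodic_pull_back[of y "(f ^^ j) y" j p] p y funpow_in
        by (metis add.commute comp_apply funpow_add)
      then have "(f ^^ j) ((f ^^ m) y) = y"
        by (metis add.commute comp_apply funpow_add)
      then have "(f ^^ j) (\<sigma> y) = \<sigma> ((f ^^ m) y)"
        using rewind[of "(f ^^ m) y" j] funpow_in y by simp
      then show ?thesis
        by (auto simp: orb_def)
    qed
    then show ?thesis
      by (auto simp: orb_def)
  qed
  have inj_\<sigma>: "inj_on \<sigma> X"
    by (metis \<sigma>(2) inj_onI)
  have orb_X: "orb f y \<subseteq> X" if "y \<in> X" for y
    using that funpow_in by (auto simp: orb_def)
  show ?thesis
  proof (cases "finite (orb f x)")
    case True
    then have fin: "finite (orb f (\<sigma> x))"
      using orb_sub[OF x] finite_subset by blast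
    have "\<sigma> ` orb f x \<subseteq> \<sigma> ` \<sigma> ` orb f (\<sigma> x)"
      using orb_sub[of "\<sigma> x"] fin \<sigma> x by (metis image_mono)
    then have eq: "orb f (\<sigma> x) = \<sigma> ` orb f x"
      using orb_sub[OF x True] orb_X[of "\<sigma> x"] \<sigma> x by (force simp: image_image)
    obtain p where p: "p > 0" "(f ^^ p) x = x"
      using recurrent_if_finite_orb x True by blast
    have "f ` orb f x = orb f (f x)"
      by (auto simp: orb_def image_image funpow_swap1)
    also have "\<dots> = orb f x"
    proof -
      have "x = (f ^^ (p - 1)) (f x)"
        using p by (cases p) (auto simp: funpow_swap1)
      then have "x \<in> orb f (f x)"
        by (auto simp: orb_def)
      then show ?thesis
        using orb_step[of x] by (simp add: insert_absorb)
    qed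
    finally have f_orb: "f ` orb f x = orb f x" .
    have "sum h (\<sigma> ` orb f x) = sum (h \<circ> \<sigma>) (f ` orb f x)"
      using inj_on_subset[OF inj_\<sigma> orb_X[OF x]] f_orb by (simp add: sum.reindex)
    also have "\<dots> = sum (h \<circ> \<sigma> \<circ> f) (orb f x)"
      using inj_on_subset[OF inj orb_X[OF x]] by (simp add: sum.reindex comp_assoc)
    also have "\<dots> = sum h (orb f x)"
      using h orb_X[OF x] by (intro sum.cong) auto
    finally show ?thesis
      using True fin by (simp add: orb_weight_def eq)
  next
    case False
    then have "infinite (orb f (\<sigma> x))"
      using orb_sub[of "\<sigma> x"] \<sigma> x finite_subset by fastforce
    with False show ?thesis
      by (simp add: orb_weight_def)
  qed
qed

end

section \<open>Codes and the first return to the induction domain\<close>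

lemma sqrt2_mult: "sqrt 2 * sqrt 2 = (2 :: real)" "sqrt 2 * (sqrt 2 * x) = 2 * x"
  "sqrt 2 * (x * sqrt 2) = 2 * x"
  by auto

lemma sqrt2_bounds: "7071 / 5000 < sqrt 2" "sqrt 2 < 14143 / 10000"
  by (rule real_less_rsqrt real_less_lsqrt; simp add: power2_eq_square)+

lemma sqrt2_cancel_less: "sqrt 2 * x < sqrt 2 * y \<longleftrightarrow> x < y"
  by simp

interpretation T: inj_self_map unit_sq Tmap
  by unfold_locales (use bij_betw_Tmap in \<open>auto simp: bij_betw_def\<close>)

lemma Tmap_eqI:
  assumes "0 \<le> w" "w < 1" "x + sqrt 2 * y + w = of_int k"
  shows "Tmap (x, y) = (y, w)"
proof -
  have "- x - sqrt 2 * y - w = of_int (- k)"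
    using assms(3) by simp
  then have "frac (- x - sqrt 2 * y) = w"
    using assms(1,2) by (metis Ints_of_int frac_unique_iff)
  then show ?thesis
    by (simp add: Tmap_def)
qed

text \<open>\<open>itinerary xs ks\<close> certifies the orbit segment \<open>(xs ! 0, xs ! 1), (xs ! 1, xs ! 2), \<dots>\<close> of \<open>Tmap\<close>, in
  which the integer added in the \<open>j\<close>-th step is \<open>ks ! j\<close>: since the numbers lie in the unit interval,
  there is only one integer that can have been added.\<close>

fun itinerary :: "real list \<Rightarrow> int list \<Rightarrow> bool" where
  "itinerary (x # y # w # xs) (k # ks) \<longleftrightarrow>
     0 \<le> x \<and> x < 1 \<and> x + sqrt 2 * y + w = of_int k \<and> itinerary (y # w # xs) ks"
| "itinerary [x, y] [] \<longleftrightarrow> 0 \<le> x \<and> x < 1 \<and> 0 \<le> y \<and> y < 1"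
| "itinerary _ _ \<longleftrightarrow> False"

lemma itinerary_unit:
  "itinerary xs ks \<Longrightarrow> 0 \<le> xs ! 0 \<and> xs ! 0 < 1 \<and> 0 \<le> xs ! 1 \<and> xs ! 1 < 1"
  by (induction xs ks rule: itinerary.induct) auto

lemma itinerary_Tmap:
  "itinerary xs ks \<Longrightarrow> j \<le> length ks \<Longrightarrow> (Tmap ^^ j) (xs ! 0, xs ! 1) = (xs ! j, xs ! Suc j)"
proof (induction xs ks arbitrary: j rule: itinerary.induct)
  case (1 x y w xs k ks)
  then have "0 \<le> w" "w < 1"
    using itinerary_unit[of "y # w # xs" ks] by auto
  with 1 have "Tmap (x, y) = (y, w)"
    by (intro Tmap_eqI) auto
  with 1 show ?case
    by (cases j) (auto simp: funpow_swap1)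
qed auto

text \<open>If \<open>u, x, y, v\<close> are consecutive entries and \<open>k\<close>, \<open>l\<close> the integers of the two steps, then
  \<open>sqrt 2 * x + y = k - u \<le> k\<close> and \<open>x + sqrt 2 * y = l - v \<le> l\<close>, so that \<open>(x, y)\<close> can lie in \<open>Dset\<close>
  only if one of the integers is at least \<open>3\<close>.\<close>

lemma itinerary_not_Dset:
  "itinerary xs ks \<Longrightarrow> \<forall>k\<in>set ks. k \<le> 2 \<Longrightarrow> 0 < j \<Longrightarrow> j < length ks \<Longrightarrow>
    (Tmap ^^ j) (xs ! 0, xs ! 1) \<notin> Dset"
proof (induction xs ks arbitrary: j rule: itinerary.induct)
  case (1 x y w xs k ks)
  then have w: "0 \<le> w" "w < 1"
    using itinerary_unit[of "y # w # xs" ks] by auto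
  with 1 have T: "Tmap (x, y) = (y, w)"
    by (intro Tmap_eqI) auto
  have k: "k \<le> 2" "x + sqrt 2 * y + w = of_int k" "0 \<le> x"
    using 1 by auto
  show ?case
  proof (cases "j = 1")
    case True
    from 1 obtain v xs' l ks' where tl: "xs = v # xs'" "ks = l # ks'"
      using True by (cases xs; cases ks) auto
    with 1 have "0 \<le> v" "l \<le> 2" "y + sqrt 2 * w + v = of_int l"
      using itinerary_unit[of "w # v # xs'" ks'] by auto
    with k have "y + sqrt 2 * w \<le> 2" "sqrt 2 * y + w \<le> 2"
      by linarith+
    then show ?thesis
      using T True by (auto simp: Dset_def)
  next
    case False
    with 1 obtain i where "j = Suc i" "0 < i" "i < length ks"
      by (cases j) auto
    with 1 T show ?thesis
      by (auto simp: funpow_swap1)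
  qed
qed auto

text \<open>The line \<open>x + sqrt 2 * y = 2\<close> cuts \<open>Dset\<close> into an open part above it, an open part below it and
  a segment on it.  On each of the three, the first return to \<open>Dset\<close> is a single affine map.\<close>

datatype part = Above | On | Below

definition part :: "real \<times> real \<Rightarrow> part" where
  "part = (\<lambda>(x, y). if x + sqrt 2 * y > 2 then Above else if x + sqrt 2 * y = 2 then On else Below)"

fun return_time :: "part \<Rightarrow> nat" where
  "return_time Above = 1"
| "return_time On = 31"
| "return_time Below = 21"

fun return_point :: "part \<Rightarrow> real \<times> real \<Rightarrow> real \<times> real" where
  "return_point Above (x, y) = (y, 3 - x - sqrt 2 * y)"
| "return_point On (x, y) = (y, x)"
| "return_point Below (x, y) = (sqrt 2 - y, x + sqrt 2 * y - 1)"

lemma part_cases [case_names Above On Below]: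
  obtains "part (x, y) = Above" "x + sqrt 2 * y > 2"
    | "part (x, y) = On" "x + sqrt 2 * y = 2"
    | "part (x, y) = Below" "x + sqrt 2 * y < 2"
  unfolding part_def by (cases "x + sqrt 2 * y > 2"; cases "x + sqrt 2 * y = 2") auto

lemma Tmap_above:
  assumes "(x, y) \<in> unit_sq" "x + sqrt 2 * y > 2"
  shows "Tmap (x, y) = (y, 3 - x - sqrt 2 * y)"
proof (rule Tmap_eqI[of _ _ _ 3])
  have "x < 1" "sqrt 2 * y < sqrt 2"
    using assms by (simp_all add: unit_sq_def)
  then show "0 \<le> 3 - x - sqrt 2 * y"
    using sqrt2_bounds by linarith
qed (use assms in auto)

lemma Dset_iff:
  "(x, y) \<in> Dset \<longleftrightarrow>
     0 \<le> x \<and> x < 1 \<and> 0 \<le> y \<and> y < 1 \<and> (sqrt 2 * x + y > 2 \<or> x + sqrt 2 * y > 2)"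
  by (auto simp: Dset_def unit_sq_def)

lemma Dset_subset: "Dset \<subseteq> unit_sq"
  by (auto simp: Dset_def)

text \<open>For linear arithmetic over the rationals, \<open>x\<close> and \<open>sqrt 2 * x\<close> are independent unknowns; hence the
  bounds come together with multiples.\<close>

lemma Dset_bounds:
  assumes "(x, y) \<in> Dset"
  shows "2 - sqrt 2 < x" "x < 1" "2 - sqrt 2 < y" "y < 1" "sqrt 2 * x + y > sqrt 2"
    "sqrt 2 * x < sqrt 2" "sqrt 2 * y < sqrt 2" "2 * sqrt 2 - 2 < sqrt 2 * x" "2 * sqrt 2 - 2 < sqrt 2 * y"
proof -
  have *: "x < 1" "y < 1" "sqrt 2 * x < sqrt 2" "sqrt 2 * y < sqrt 2"
    "sqrt 2 * x + y > 2 \<or> x + sqrt 2 * y > 2"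
    using assms by (auto simp: Dset_iff)
  then have "sqrt 2 * x + y > 2 \<and> 2 * x + sqrt 2 * y > 2 * sqrt 2 \<or>
    x + sqrt 2 * y > 2 \<and> sqrt 2 * x + 2 * y > 2 * sqrt 2"
    using sqrt2_cancel_less[of 2 "sqrt 2 * x + y"] sqrt2_cancel_less[of 2 "x + sqrt 2 * y"]
    unfolding distrib_left sqrt2_mult by linarith
  with * show "2 - sqrt 2 < x" "x < 1" "2 - sqrt 2 < y" "y < 1" "sqrt 2 * x + y > sqrt 2"
    "sqrt 2 * x < sqrt 2" "sqrt 2 * y < sqrt 2" "2 * sqrt 2 - 2 < sqrt 2 * x" "2 * sqrt 2 - 2 < sqrt 2 * y"
    using sqrt2_bounds by linarith+
qed

definition returns :: "real \<times> real \<Rightarrow> nat \<Rightarrow> real \<times> real \<Rightarrow> bool" where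
  "returns z t w \<longleftrightarrow> 0 < t \<and> (Tmap ^^ t) z = w \<and> w \<in> Dset \<and> (\<forall>j. 0 < j \<longrightarrow> j < t \<longrightarrow> (Tmap ^^ j) z \<notin> Dset)"

lemma returns_by_itinerary:
  assumes "itinerary xs ks" "\<forall>k\<in>set ks. k \<le> 2" "ks \<noteq> []"
    and "z = (xs ! 0, xs ! 1)" "w = (xs ! length ks, xs ! Suc (length ks))" "w \<in> Dset"
  shows "returns z (length ks) w"
  using assms itinerary_Tmap[OF assms(1), of "length ks"] itinerary_not_Dset[OF assms(1,2)]
  by (auto simp: returns_def)

text \<open>Every entry of the itinerary is, up to a constant, one of the four forms \<open>x\<close>, \<open>y\<close>,
  \<open>x + sqrt 2 * y\<close>, \<open>sqrt 2 * x + y\<close> with a sign, because the fourth power of the linear part of \<open>Tmap\<close>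
  is \<open>-1\<close>.  The bounds are the extreme values of these forms at the vertices of the triangle below the line.\<close>

lemma returns_below:
  assumes "(x, y) \<in> Dset" "x + sqrt 2 * y < 2"
  shows "returns (x, y) 21 (sqrt 2 - y, x + sqrt 2 * y - 1)"
proof -
  have *: "0 \<le> x" "x < 1" "0 \<le> y" "y < 1" "sqrt 2 * x < sqrt 2" "sqrt 2 * x + y > 2"
    using assms by (auto simp: Dset_iff)
  moreover from this assms have "2 * x + sqrt 2 * y > 2 * sqrt 2" "sqrt 2 * x + 2 * y < 2 * sqrt 2"
    using sqrt2_cancel_less[of 2 "sqrt 2 * x + y"] sqrt2_cancel_less[of "x + sqrt 2 * y" 2]
    unfolding distrib_left sqrt2_mult by linarith+
  ultimately have bounds: "x > 2 * sqrt 2 - 2" "x < 1" "y > 2 - sqrt 2" "y < 2 * sqrt 2 - 2"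
    "x + sqrt 2 * y > 2 * sqrt 2 - 1" "x + sqrt 2 * y < 2"
    "sqrt 2 * x + y > 2" "sqrt 2 * x + y < 3 / 2 * sqrt 2"
    using assms(2) by linarith+
  let ?xs = "[x, y, - x - sqrt 2 * y + 2, sqrt 2 * x + y + 1 - 2 * sqrt 2, - x + 3 - sqrt 2,
      - y + 3 - sqrt 2, x + sqrt 2 * y + 1 - 2 * sqrt 2, - sqrt 2 * x - y + 3, x + 1 - sqrt 2,
      y + 1 - sqrt 2, - x - sqrt 2 * y + 2, sqrt 2 * x + y - sqrt 2, - x + 1, - y + 1,
      x + sqrt 2 * y - sqrt 2, - sqrt 2 * x - y + 3, x + 2 - 2 * sqrt 2, y + 3 - 2 * sqrt 2,
      - x - sqrt 2 * y + 4 - sqrt 2, sqrt 2 * x + y + 1 - 2 * sqrt 2, - x + 1, - y + sqrt 2,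
      x + sqrt 2 * y - 1]"
  let ?ks = "[2, 1, 1, 2, 2, 2, 2, 2, 1, 1, 1, 1, 1, 2, 2, 2, 2, 2, 1, 1, 2] :: int list"
  have it: "itinerary ?xs ?ks"
    using bounds sqrt2_bounds unfolding itinerary.simps
    by (intro conjI; (linarith | simp add: algebra_simps sqrt2_mult))
  have "(sqrt 2 - y, x + sqrt 2 * y - 1) \<in> Dset"
  proof -
    have "sqrt 2 - y + sqrt 2 * (x + sqrt 2 * y - 1) = sqrt 2 * x + y"
      by (simp add: algebra_simps sqrt2_mult)
    then show ?thesis
      unfolding Dset_iff using bounds sqrt2_bounds by (intro conjI disjI2) linarith+
  qed
  then show ?thesis
    using returns_by_itinerary[OF it _ _ refl refl] by (simp add: algebra_simps eval_nat_numeral)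
qed

lemma returns_on:
  assumes "(x, y) \<in> Dset" "x + sqrt 2 * y = 2"
  shows "returns (x, y) 31 (y, x)"
proof -
  have "x < 1" "sqrt 2 * x + y > 2" "sqrt 2 * x < sqrt 2"
    using assms by (auto simp: Dset_iff)
  moreover from this assms have "2 * x + sqrt 2 * y > 2 * sqrt 2" "sqrt 2 * x + 2 * y = 2 * sqrt 2"
    using sqrt2_cancel_less[of 2 "sqrt 2 * x + y"] arg_cong[OF assms(2), of "\<lambda>u. sqrt 2 * u"]
    unfolding distrib_left sqrt2_mult by linarith+
  ultimately have y: "y = - sqrt 2 * x / 2 + sqrt 2"
    and bounds: "x > 2 * sqrt 2 - 2" "x < 1" "sqrt 2 * x > 4 - 2 * sqrt 2" "sqrt 2 * x < sqrt 2"
    using assms(2) sqrt2_bounds by linarith+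
  let ?xs = "[x, - sqrt 2 * x / 2 + sqrt 2, 0, sqrt 2 * x / 2 + 1 - sqrt 2, - x + 3 - sqrt 2,
      sqrt 2 * x / 2 + 3 - 2 * sqrt 2, 3 - 2 * sqrt 2, - sqrt 2 * x / 2 + 3 - sqrt 2, x + 1 - sqrt 2,
      - sqrt 2 * x / 2 + 1, 0, sqrt 2 * x / 2, - x + 1, sqrt 2 * x / 2 + 1 - sqrt 2, 2 - sqrt 2,
      - sqrt 2 * x / 2 + 3 - sqrt 2, x + 2 - 2 * sqrt 2, - sqrt 2 * x / 2 + 3 - sqrt 2, 2 - sqrt 2,
      sqrt 2 * x / 2 + 1 - sqrt 2, - x + 1, sqrt 2 * x / 2, 0, - sqrt 2 * x / 2 + 1, x + 1 - sqrt 2,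
      - sqrt 2 * x / 2 + 3 - sqrt 2, 3 - 2 * sqrt 2, sqrt 2 * x / 2 + 3 - 2 * sqrt 2,
      - x + 3 - sqrt 2, sqrt 2 * x / 2 + 1 - sqrt 2, 0, - sqrt 2 * x / 2 + sqrt 2, x]"
  let ?ks = "[2, 1, 1, 2, 2, 2, 2, 2, 1, 1, 1, 1, 1, 2, 2, 2, 2, 2, 1, 1, 1, 1, 1, 2, 2, 2, 2, 2, 1, 1, 2] :: int list"
  have it: "itinerary ?xs ?ks"
    using bounds sqrt2_bounds unfolding itinerary.simps
    by (intro conjI; (linarith | simp add: algebra_simps sqrt2_mult))
  have "(y, x) \<in> Dset"
    using assms by (auto simp: Dset_iff)
  then show ?thesis
    using returns_by_itinerary[OF it _ _ refl refl] by (simp add: y algebra_simps eval_nat_numeral)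
qed

lemma returns_above:
  assumes "(x, y) \<in> Dset" "x + sqrt 2 * y > 2"
  shows "returns (x, y) 1 (y, 3 - x - sqrt 2 * y)"
proof -
  have "Tmap (x, y) = (y, 3 - x - sqrt 2 * y)"
    using assms Dset_subset by (intro Tmap_above) auto
  moreover from this have "(y, 3 - x - sqrt 2 * y) \<in> unit_sq"
    using assms Dset_subset T.maps by (metis subsetD)
  moreover have "sqrt 2 * y + (3 - x - sqrt 2 * y) > 2"
    using assms by (auto simp: Dset_iff)
  ultimately show ?thesis
    by (auto simp: returns_def Dset_def)
qed

lemma first_return:
  assumes "z \<in> Dset"
  shows "returns z (return_time (part z)) (return_point (part z) z)"
proof (cases z)
  case (Pair x y)
  then show ?thesis
    using assms returns_above returns_on returns_below
    by (cases x y rule: part_cases) auto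
qed

lemma That_eq_return_point:
  assumes "z \<in> Dset"
  shows "That z = return_point (part z) z"
proof -
  define t where "t = return_time (part z)"
  have t: "returns z t (return_point (part z) z)"
    using first_return[OF assms] by (simp add: t_def)
  then obtain n where n: "t = Suc n"
    by (cases t) (auto simp: returns_def)
  have "(LEAST m. (Tmap ^^ m) (Tmap z) \<in> Dset) = n"
  proof (rule Least_equality)
    show "(Tmap ^^ n) (Tmap z) \<in> Dset"
      using t n by (auto simp: returns_def funpow_swap1)
    show "n \<le> m" if "(Tmap ^^ m) (Tmap z) \<in> Dset" for m
    proof (rule ccontr)
      assume "\<not> n \<le> m"
      with n have "0 < Suc m" "Suc m < t" by auto
      with t have "(Tmap ^^ Suc m) z \<notin> Dset"
        unfolding returns_def by blast
      with that show False
        by (simp add: funpow_swap1)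
    qed
  qed
  then show ?thesis
    using t n by (simp add: That_def Rmap_def returns_def funpow_swap1)
qed

lemma That_in_Dset: "z \<in> Dset \<Longrightarrow> That z \<in> Dset"
  using first_return That_eq_return_point by (auto simp: returns_def)

text \<open>The exchange of coordinates conjugates \<open>That\<close> to its inverse, as it does with \<open>Tmap\<close>.\<close>

lemma swap_Dset: "z \<in> Dset \<Longrightarrow> prod.swap z \<in> Dset"
  by (cases z) (auto simp: Dset_iff)

lemma part_swap_That:
  assumes "z \<in> Dset"
  shows "part (prod.swap (That z)) = part z"
proof (cases z)
  case (Pair x y)
  then show ?thesis
    using assms That_eq_return_point[OF assms]
    by (cases x y rule: part_cases) (auto simp: part_def Dset_iff algebra_simps sqrt2_mult)
qed

lemma That_swap_That:
  assumes "z \<in> Dset"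
  shows "That (prod.swap (That z)) = prod.swap z"
proof -
  have "That (prod.swap (That z)) = return_point (part z) (prod.swap (return_point (part z) z))"
    using assms swap_Dset That_in_Dset That_eq_return_point part_swap_That by metis
  also have "\<dots> = prod.swap z"
    by (cases z; cases "part z") (auto simp: algebra_simps sqrt2_mult)
  finally show ?thesis .
qed

interpretation That: inj_self_map Dset That
proof
  show "inj_on That Dset"
    by (metis inj_onI That_swap_That swap_swap)
qed (rule That_in_Dset)

lemma bij_betw_That: "bij_betw That Dset Dset"
proof -
  have "w \<in> That ` Dset" if "w \<in> Dset" for w
    using That_swap_That[of "prod.swap w"] swap_Dset[of w] that
      swap_Dset[OF That_in_Dset[OF swap_Dset[OF that]]] by (metis image_eqI swap_swap)
  then show ?thesis
    using That.inj That_in_Dset by (auto simp: bij_betw_def)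
qed

section \<open>Renormalization\<close>

lemma period_eq_orb_weight:
  assumes "z \<in> unit_sq"
  shows "period z = orb_weight Tmap (\<lambda>_. 1) z"
proof (cases "\<exists>p\<ge>1. (Tmap ^^ p) z = z")
  case True
  define p where "p = (LEAST p. 1 \<le> p \<and> (Tmap ^^ p) z = z)"
  have p: "1 \<le> p \<and> (Tmap ^^ p) z = z"
    unfolding p_def using True by (rule LeastI_ex)
  have "(Tmap ^^ d) z \<noteq> z" if "0 < d" "d < p" for d
    using not_less_Least[of d "\<lambda>p. 1 \<le> p \<and> (Tmap ^^ p) z = z"] that by (auto simp: p_def)
  then have "orb_weight Tmap (\<lambda>_. 1) z = enat (\<Sum>j<p. 1)"
    using p assms by (intro T.orb_weight_periodic) auto
  moreover have "period z = enat p"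
    using True by (simp add: period_def p_def)
  ultimately show ?thesis
    by simp
next
  case False
  then have "infinite (orb Tmap z)"
    by (metis T.recurrent_if_finite_orb[OF assms] Suc_leI One_nat_def)
  with False show ?thesis
    by (auto simp: period_def orb_weight_def)
qed

lemma orb_weight_eq_infinity_iff: "orb_weight f h x = \<infinity> \<longleftrightarrow> infinite (orb f x)"
  by (simp add: orb_weight_def)

lemma orb_weight_ge:
  assumes "\<And>y. c \<le> h y"
  shows "enat c \<le> orb_weight f h x"
proof (cases "finite (orb f x)")
  case True
  have x: "x \<in> orb f x"
    unfolding orb_def by (rule range_eqI[of _ _ 0]) simp
  have "c \<le> h x" by (rule assms)
  also have "h x \<le> sum h (orb f x)"
    using x True by (rule member_le_sum[OF _ zero_le])
  finally show ?thesis
    using True by (simp add: orb_weight_def)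
qed (simp add: orb_weight_def)

lemma orb_weight_first_return:
  assumes "z \<in> Dset"
  shows "orb_weight Tmap (\<lambda>_. 1) z = orb_weight That (\<lambda>u. return_time (part u)) z"
proof -
  have "orb_weight Tmap (\<lambda>_. 1) (id z)
      = orb_weight That (\<lambda>u. \<Sum>j<return_time (part u). 1) z"
    by (rule T.orb_weight_tower[of _ Dset])
      (use assms first_return That_in_Dset Dset_subset That_eq_return_point in \<open>auto simp: returns_def\<close>)
  then show ?thesis by simp
qed

text \<open>Composing the contraction \<open>Umap\<close> with the exchange of coordinates turns the first return map
  to \<open>Umap ` Dset\<close>, which \<open>Umap\<close> conjugates to the inverse of \<open>That\<close>, into a copy of \<open>That\<close> itself.\<close>

definition Vmap :: "real \<times> real \<Rightarrow> real \<times> real" where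
  "Vmap z = Umap (prod.swap z)"

lemma Vmap_eq: "Vmap (x, y) = (sqrt 2 * y - y + 2 - sqrt 2, sqrt 2 * x - x + 2 - sqrt 2)"
  by (simp add: Vmap_def Umap_def algebra_simps)

lemma inj_Umap: "inj Umap"
  by (rule injI) (auto simp: Umap_def prod_eq_iff)

lemma inj_Vmap: "inj Vmap"
  using inj_Umap by (auto simp: inj_def Vmap_def)

lemma Vmap_image: "Vmap ` Dset = Umap ` Dset"
  using swap_Dset by (force simp: Vmap_def intro: rev_image_eqI[of "prod.swap z" for z])

lemma Dset_scaled_bounds:
  assumes "(x, y) \<in> Dset"
  shows "sqrt 2 * x - x < sqrt 2 - 1" "3 * sqrt 2 - 4 < sqrt 2 * x - x"
    "sqrt 2 * y - y < sqrt 2 - 1" "3 * sqrt 2 - 4 < sqrt 2 * y - y"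
    "2 - sqrt 2 < 2 * x + sqrt 2 * y - sqrt 2 * x - y"
    "2 - sqrt 2 < 2 * y + sqrt 2 * x - sqrt 2 * y - x"
proof -
  have "(sqrt 2 - 1) * (1 - x) > 0" "(sqrt 2 - 1) * (x - (2 - sqrt 2)) > 0"
    "(sqrt 2 - 1) * (1 - y) > 0" "(sqrt 2 - 1) * (y - (2 - sqrt 2)) > 0"
    "(sqrt 2 - 1) * (sqrt 2 * x + y - sqrt 2) > 0" "(sqrt 2 - 1) * (sqrt 2 * y + x - sqrt 2) > 0"
    using Dset_bounds[OF assms] Dset_bounds[OF swap_Dset[OF assms, simplified]]
    by (auto intro!: mult_pos_pos)
  then show "sqrt 2 * x - x < sqrt 2 - 1" "3 * sqrt 2 - 4 < sqrt 2 * x - x"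
    "sqrt 2 * y - y < sqrt 2 - 1" "3 * sqrt 2 - 4 < sqrt 2 * y - y"
    "2 - sqrt 2 < 2 * x + sqrt 2 * y - sqrt 2 * x - y"
    "2 - sqrt 2 < 2 * y + sqrt 2 * x - sqrt 2 * y - x"
    unfolding left_diff_distrib right_diff_distrib distrib_left sqrt2_mult by linarith+
qed

lemma Vmap_in_Dset:
  assumes "z \<in> Dset"
  shows "Vmap z \<in> Dset" "part (Vmap z) = Above"
proof -
  obtain x y where z: "z = (x, y)" by (cases z)
  note b = Dset_bounds[OF assms[unfolded z]] Dset_scaled_bounds[OF assms[unfolded z]] sqrt2_bounds
  have "0 \<le> sqrt 2 * y - y + 2 - sqrt 2" "sqrt 2 * y - y + 2 - sqrt 2 < 1"
    "0 \<le> sqrt 2 * x - x + 2 - sqrt 2" "sqrt 2 * x - x + 2 - sqrt 2 < 1"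
    using b by linarith+
  moreover have "sqrt 2 * y - y + 2 - sqrt 2 + sqrt 2 * (sqrt 2 * x - x + 2 - sqrt 2) > 2"
    using b unfolding right_diff_distrib distrib_left sqrt2_mult by linarith
  ultimately show "Vmap z \<in> Dset" "part (Vmap z) = Above"
    by (auto simp: z Vmap_eq Dset_iff part_def)
qed

lemma Vmap_image_iff:
  assumes "(x, y) \<in> Dset"
  shows "(x, y) \<in> Vmap ` Dset \<longleftrightarrow>
    sqrt 2 * x + y > 3 * sqrt 2 - 2 \<or> x + sqrt 2 * y > 3 * sqrt 2 - 2"
proof -
  define u where "u = sqrt 2 * y + y - sqrt 2"
  define v where "v = sqrt 2 * x + x - sqrt 2"
  have xy: "(x, y) = Vmap (u, v)"
    by (simp add: Vmap_eq u_def v_def algebra_simps sqrt2_mult)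
  then have "(x, y) \<in> Vmap ` Dset \<longleftrightarrow> (u, v) \<in> Dset"
    using inj_Vmap by (auto simp: inj_def)
  also have "\<dots> \<longleftrightarrow> sqrt 2 * u + v > 2 \<or> u + sqrt 2 * v > 2"
  proof -
    have "0 \<le> u" "u < 1" "0 \<le> v" "v < 1"
      using Dset_bounds[OF assms] unfolding u_def v_def by linarith+
    then show ?thesis
      by (auto simp: Dset_iff)
  qed
  also have "\<dots> \<longleftrightarrow> (sqrt 2 + 1) * (x + sqrt 2 * y - (3 * sqrt 2 - 2)) > 0 \<or>
      (sqrt 2 + 1) * (sqrt 2 * x + y - (3 * sqrt 2 - 2)) > 0"
    by (simp add: u_def v_def algebra_simps sqrt2_mult)
  also have "\<dots> \<longleftrightarrow> sqrt 2 * x + y > 3 * sqrt 2 - 2 \<or> x + sqrt 2 * y > 3 * sqrt 2 - 2"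
    using sqrt2_bounds by (simp add: zero_less_mult_iff disj_commute)
  finally show ?thesis .
qed

lemma That_above: "(x, y) \<in> Dset \<Longrightarrow> x + sqrt 2 * y > 2 \<Longrightarrow> That (x, y) = (y, 3 - x - sqrt 2 * y)"
  and That_on: "(x, y) \<in> Dset \<Longrightarrow> x + sqrt 2 * y = 2 \<Longrightarrow> That (x, y) = (y, x)"
  and That_below: "(x, y) \<in> Dset \<Longrightarrow> x + sqrt 2 * y < 2 \<Longrightarrow> That (x, y) = (sqrt 2 - y, x + sqrt 2 * y - 1)"
  by (auto simp: That_eq_return_point part_def)

fun dual :: "part \<Rightarrow> part" where
  "dual Above = Below"
| "dual On = On"
| "dual Below = Above"

text \<open>The excursion from \<open>Vmap z\<close> visits first a point above the line, then one on the side opposite to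
  \<open>z\<close>, because the defect \<open>x + sqrt 2 * y - 2\<close> of the second point is the one of \<open>z\<close> times
  \<open>1 - sqrt 2\<close>, and then a point above the line again.\<close>

lemma renormalization:
  assumes "z \<in> Dset"
  shows "That (Vmap z) \<notin> Vmap ` Dset" "part (That (Vmap z)) = dual (part z)"
    "That (That (Vmap z)) \<notin> Vmap ` Dset" "part (That (That (Vmap z))) = Above"
    "That (That (That (Vmap z))) = Vmap (That z)"
proof -
  obtain x y where z: "z = (x, y)" by (cases z)
  note b = Dset_bounds[OF assms[unfolded z]] Dset_scaled_bounds[OF assms[unfolded z]] sqrt2_bounds
  define w1 where "w1 = (sqrt 2 * x - x + 2 - sqrt 2, 3 - sqrt 2 + y - sqrt 2 * y - 2 * x + sqrt 2 * x)"
  have D: "Vmap z \<in> Dset" "That (Vmap z) \<in> Dset" "That (That (Vmap z)) \<in> Dset"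
    using assms Vmap_in_Dset That_in_Dset by auto
  have w1: "That (Vmap z) = w1"
    using D(1) Vmap_in_Dset(2)[OF assms]
    by (auto simp: That_eq_return_point z Vmap_eq w1_def algebra_simps sqrt2_mult)
  show "That (Vmap z) \<notin> Vmap ` Dset"
    using D(2) b unfolding w1 w1_def
    by (auto simp: Vmap_image_iff algebra_simps sqrt2_mult)
  have w1_side: "fst w1 + sqrt 2 * snd w1 - 2 = (sqrt 2 - 1) * (2 - x - sqrt 2 * y)"
    by (simp add: w1_def algebra_simps sqrt2_mult)
  show w1_part: "part (That (Vmap z)) = dual (part z)"
    unfolding w1
  proof (cases x y rule: part_cases)
    case Above
    then have "(sqrt 2 - 1) * (2 - x - sqrt 2 * y) < 0"
      by (intro mult_pos_neg) auto
    with w1_side have "fst w1 + sqrt 2 * snd w1 < 2"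
      by linarith
    then show "part w1 = dual (part z)"
      using Above by (simp add: z part_def case_prod_beta)
  next
    case On
    then have "2 - x - sqrt 2 * y = 0"
      by linarith
    with w1_side have "fst w1 + sqrt 2 * snd w1 = 2"
      by simp
    then show "part w1 = dual (part z)"
      using On by (simp add: z part_def case_prod_beta)
  next
    case Below
    then have "(sqrt 2 - 1) * (2 - x - sqrt 2 * y) > 0"
      by (intro mult_pos_pos) auto
    with w1_side have "fst w1 + sqrt 2 * snd w1 > 2"
      by linarith
    then show "part w1 = dual (part z)"
      using Below by (simp add: z part_def case_prod_beta)
  qed
  define w2 where "w2 = return_point (dual (part z)) w1"
  have w2: "That (That (Vmap z)) = w2"
    using That_eq_return_point[OF D(2)] w1_part by (simp add: w2_def w1)
  have in_V: "w2 \<in> Vmap ` Dset \<longleftrightarrow>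
      sqrt 2 * fst w2 + snd w2 > 3 * sqrt 2 - 2 \<or> fst w2 + sqrt 2 * snd w2 > 3 * sqrt 2 - 2"
    using Vmap_image_iff[of "fst w2" "snd w2"] D(3) w2 by simp
  have "sqrt 2 * fst w2 + snd w2 \<le> 3 * sqrt 2 - 2 \<and> fst w2 + sqrt 2 * snd w2 \<le> 3 * sqrt 2 - 2 \<and>
      2 < fst w2 + sqrt 2 * snd w2 \<and>
      (snd w2, 3 - fst w2 - sqrt 2 * snd w2) = Vmap (That z)"
    using b assms
    by (cases x y rule: part_cases)
      (auto simp: w2_def w1_def z That_eq_return_point Vmap_eq algebra_simps sqrt2_mult)
  then show "That (That (Vmap z)) \<notin> Vmap ` Dset" "part (That (That (Vmap z))) = Above"
    "That (That (That (Vmap z))) = Vmap (That z)"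
    using in_V That_above[of "fst w2" "snd w2"] D(3) unfolding w2
    by (auto simp: part_def case_prod_beta)
qed

lemma orb_weight_Vmap:
  assumes "z \<in> Dset"
  shows "orb_weight That (\<lambda>u. h (part u)) (Vmap z)
    = orb_weight That (\<lambda>u. 2 * h Above + h (dual (part u))) z"
proof -
  have sum3: "(\<Sum>j<3. g j) = g 0 + g 1 + g 2" for g :: "nat \<Rightarrow> nat"
    by (simp add: numeral_3_eq_3 numeral_2_eq_2)
  have "orb_weight That (\<lambda>u. h (part u)) (Vmap z)
      = orb_weight That (\<lambda>u. \<Sum>j<3. h (part ((That ^^ j) (Vmap u)))) z"
  proof (rule That.orb_weight_tower[of _ Dset])
    show "(That ^^ j) (Vmap u) \<notin> Vmap ` Dset" if "u \<in> Dset" "0 < j" "j < 3" for u j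
    proof -
      have "j = 1 \<or> j = 2"
        using that by auto
      then show ?thesis
        using renormalization[OF \<open>u \<in> Dset\<close>] by (auto simp: numeral_2_eq_2)
    qed
  qed (use assms inj_Vmap Vmap_in_Dset That_in_Dset renormalization in
        \<open>auto simp: numeral_3_eq_3 intro: inj_on_subset\<close>)
  also have "\<dots> = orb_weight That (\<lambda>u. 2 * h Above + h (dual (part u))) z"
  proof -
    have "(\<Sum>j<3. h (part ((That ^^ j) (Vmap u)))) = 2 * h Above + h (dual (part u))"
      if "u \<in> orb That z" for u
    proof -
      have "u \<in> Dset"
        using that That.funpow_in[OF assms] by (auto simp: orb_def)
      then show ?thesis
        using renormalization[of u] Vmap_in_Dset[of u] unfolding sum3 by (simp add: numeral_2_eq_2)
    qed
    then show ?thesis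
      by (simp add: orb_weight_def)
  qed
  finally show ?thesis .
qed

lemma orb_weight_swap:
  assumes "z \<in> Dset"
  shows "orb_weight That (\<lambda>u. h (part u)) (prod.swap z) = orb_weight That (\<lambda>u. h (part u)) z"
  by (rule That.orb_weight_reversed)
    (use assms swap_Dset That_swap_That part_swap_That in auto)

lemma int_iter_That:
  assumes "z \<in> Dset"
  shows "int_iter Dset That k z \<in> Dset \<and> orb_weight That h (int_iter Dset That k z) = orb_weight That h z"
proof (cases "0 \<le> k")
  case True
  then show ?thesis
    using assms That.funpow_in That.orb_weight_funpow by (simp add: int_iter_def)
next
  case False
  have "(inv_into Dset That ^^ n) z \<in> Dset \<and>
      orb_weight That h ((inv_into Dset That ^^ n) z) = orb_weight That h z" for n
  proof (induction n)
    case (Suc n)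
    define u where "u = inv_into Dset That ((inv_into Dset That ^^ n) z)"
    have "(inv_into Dset That ^^ n) z \<in> That ` Dset"
      using Suc bij_betw_That by (auto simp: bij_betw_def)
    then have "u \<in> Dset" "That u = (inv_into Dset That ^^ n) z"
      by (auto simp: u_def inv_into_into f_inv_into_f)
    with Suc That.orb_weight_step[of u h] show ?case
      by (simp add: u_def)
  qed (use assms in auto)
  with False show ?thesis
    by (simp add: int_iter_def)
qed

lemma Smap_weight:
  assumes "admissible s" "w \<in> Dset - Pset"
  shows "Smap s w \<in> Dset"
    "orb_weight That (\<lambda>u. h (part u)) w = orb_weight That (\<lambda>u. 2 * h Above + h (dual (part u))) (Smap s w)"
proof -
  have "int_iter Dset That (s w) w \<in> Umap ` Dset"
    using assms by (auto simp: admissible_def)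
  then obtain v where v: "v \<in> Dset" "int_iter Dset That (s w) w = Umap v"
    by auto
  then have S: "Smap s w = v"
    using inj_Umap by (simp add: Smap_def)
  with v show "Smap s w \<in> Dset" by simp
  have "orb_weight That (\<lambda>u. h (part u)) w = orb_weight That (\<lambda>u. h (part u)) (Vmap (prod.swap v))"
    using int_iter_That[of w "s w" "\<lambda>u. h (part u)"] assms v by (simp add: Vmap_def)
  also have "\<dots> = orb_weight That (\<lambda>u. 2 * h Above + h (dual (part u))) v"
    using orb_weight_Vmap[OF swap_Dset[OF v(1)], of h]
      orb_weight_swap[OF v(1), of "\<lambda>p. 2 * h Above + h (dual p)"] by simp
  finally show "orb_weight That (\<lambda>u. h (part u)) w
      = orb_weight That (\<lambda>u. 2 * h Above + h (dual (part u))) (Smap s w)"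
    by (simp add: S)
qed

lemma Rmap_weight:
  assumes "z \<in> unit_sq - Rset"
  shows "Rmap z \<in> Dset" "orb_weight Tmap h (Rmap z) = orb_weight Tmap h z"
proof -
  have "\<exists>m. (Tmap ^^ m) z \<in> Dset"
    using assms by (auto simp: Rset_def)
  then show "Rmap z \<in> Dset"
    unfolding Rmap_def by (rule LeastI_ex)
  show "orb_weight Tmap h (Rmap z) = orb_weight Tmap h z"
    unfolding Rmap_def using assms by (intro T.orb_weight_funpow) auto
qed

text \<open>The time that \<open>Tmap\<close> needs for the copy of one step of \<open>That\<close> in the \<open>n\<close> times contracted
  domain; the recursion reads off the three steps of an excursion.\<close>

fun level_time :: "nat \<Rightarrow> part \<Rightarrow> nat" where
  "level_time 0 p = return_time p"
| "level_time (Suc n) p = 2 * level_time n Above + level_time n (dual p)"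

lemma level_time:
  "int (level_time n Above) = 2 * 3 ^ (n + 1) - 5 * (- 1) ^ n"
  "int (level_time n Below) = 2 * 3 ^ (n + 1) + 15 * (- 1) ^ n"
  "int (level_time n On) = 2 * 3 ^ (n + 1) + 20 + 5 * (- 1) ^ n"
  by (induction n) auto

lemma SnR_weight:
  assumes "z \<in> unit_sq" "admissible s" "SnR s n z = Some w"
  shows "w \<in> Dset \<and> period z = orb_weight That (\<lambda>u. level_time n (part u)) w \<and>
    orb_weight That (\<lambda>_. 1) (Rmap z) = orb_weight That (\<lambda>_. 3 ^ n) w"
  using assms(3)
proof (induction n arbitrary: w)
  case 0
  then have "w = Rmap z" "z \<in> unit_sq - Rset"
    by (auto split: if_splits)
  then show ?case
    using Rmap_weight(1)[of z] Rmap_weight(2)[of z "\<lambda>_. 1"] orb_weight_first_return[of w] period_eq_orb_weight[of z] by simp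
next
  case (Suc n)
  then obtain v where v: "SnR s n z = Some v" "v \<in> Dset - Pset" "w = Smap s v"
    by (auto split: option.splits if_splits)
  show ?case
    using Suc.IH[OF v(1)] Smap_weight(1)[OF assms(2) v(2)] Smap_weight(2)[OF assms(2) v(2), of "level_time n"]
      Smap_weight(2)[OF assms(2) v(2), of "\<lambda>_. 3 ^ n"] by (simp add: v(3))
qed

text \<open>A finite orbit cannot be renormalized forever, because each renormalization divides the number of
  its points in \<open>Dset\<close> by three.\<close>

lemma period_infinite:
  assumes z: "z \<in> unit_sq" and s: "admissible s" and SnR: "\<And>n. \<exists>w. SnR s n z = Some w"
  shows "period z = \<infinity>"
proof (rule ccontr)
  obtain w where w: "SnR s 0 z = Some w"
    using SnR by blast
  then have "w = Rmap z"
    by (auto split: if_splits)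
  moreover assume "period z \<noteq> \<infinity>"
  ultimately have "finite (orb That (Rmap z))"
    using SnR_weight[OF z s w] orb_weight_eq_infinity_iff by metis
  then obtain c where c: "orb_weight That (\<lambda>_. 1) (Rmap z) = enat c"
    by (auto simp: orb_weight_def)
  have "3 ^ n \<le> c" for n
  proof -
    obtain w where "SnR s n z = Some w"
      using SnR by blast
    then have "enat c = orb_weight That (\<lambda>_. 3 ^ n) w"
      using SnR_weight[OF z s] c by metis
    then show ?thesis
      using orb_weight_ge[of "3 ^ n" "\<lambda>_. 3 ^ n" That w] by (metis enat_ord_simps(1) order_refl)
  qed
  then have "3 ^ c \<le> c" .
  moreover have "c < 3 ^ c"
    by (induction c) auto
  ultimately show False by simp
qed

section \<open>Orbits that avoid the renormalized copy\<close>

lemma That_avoiding_not_below: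
  assumes "w \<in> Dset" "That (That w) \<notin> Vmap ` Dset"
  shows "part w \<noteq> Below"
proof
  obtain x y where w: "w = (x, y)" by (cases w)
  assume "part w = Below"
  then have below: "x + sqrt 2 * y < 2"
    by (auto simp: w part_def split: if_splits)
  then have *: "sqrt 2 * x + y > 2" "x < 1"
    using assms by (auto simp: w Dset_iff)
  have w': "That w = (sqrt 2 - y, x + sqrt 2 * y - 1)"
    using That_below assms below by (simp add: w)
  have "sqrt 2 - y + sqrt 2 * (x + sqrt 2 * y - 1) = sqrt 2 * x + y"
    by (simp add: algebra_simps sqrt2_mult)
  then have w'': "That (That w) = (x + sqrt 2 * y - 1, 3 - (sqrt 2 * x + y))"
    using That_above[of "sqrt 2 - y" "x + sqrt 2 * y - 1"] That_in_Dset[OF assms(1)] *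
    by (simp add: w' algebra_simps)
  have "x + sqrt 2 * y - 1 + sqrt 2 * (3 - (sqrt 2 * x + y)) = 3 * sqrt 2 - 1 - x"
    by (simp add: algebra_simps sqrt2_mult)
  then have "That (That w) \<in> Vmap ` Dset"
    using Vmap_image_iff That_in_Dset[OF That_in_Dset[OF assms(1)]] * unfolding w'' by simp
  with assms show False by simp
qed

text \<open>On the segment, \<open>That\<close> exchanges the coordinates.  The image lies on the line
  \<open>sqrt 2 * x + y = 2\<close>, and only its part \<open>Dbeta\<close> with the end point \<open>5 - 3 * sqrt 2\<close> is not mapped into
  the renormalized copy by the next step.\<close>

lemma That_avoiding_on:
  assumes "w \<in> Dset" "part w = On" "That (That w) \<notin> Vmap ` Dset"
  obtains a where "That w = (a, 2 - sqrt 2 * a)" "5 - 3 * sqrt 2 \<le> a" "a < 2 * sqrt 2 - 2"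
proof -
  obtain x a where w: "w = (x, a)" by (cases w)
  have x: "x = 2 - sqrt 2 * a"
    using assms by (auto simp: w part_def split: if_splits)
  have "sqrt 2 * x + a = 2 * sqrt 2 - a" "x + sqrt 2 * a = 2"
    unfolding x by (simp_all add: algebra_simps sqrt2_mult)
  then have a: "a < 2 * sqrt 2 - 2"
    using assms by (auto simp: w Dset_iff)
  have w': "That w = (a, 2 - sqrt 2 * a)"
    using That_on assms(1) \<open>x + sqrt 2 * a = 2\<close> by (simp add: w x)
  have "a + sqrt 2 * (2 - sqrt 2 * a) > 2"
    using a by (simp add: algebra_simps sqrt2_mult)
  then have w'': "That (That w) = (2 - sqrt 2 * a, 3 - 2 * sqrt 2 + a)"
    using That_above[of a "2 - sqrt 2 * a"] That_in_Dset[OF assms(1)]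
    by (simp add: w' algebra_simps sqrt2_mult)
  have "sqrt 2 * (2 - sqrt 2 * a) + (3 - 2 * sqrt 2 + a) = 3 - a"
    by (simp add: algebra_simps sqrt2_mult)
  then have "5 - 3 * sqrt 2 \<le> a"
    using Vmap_image_iff That_in_Dset[OF That_in_Dset[OF assms(1)]] assms(3) unfolding w'' by fastforce
  with that a w' show ?thesis by blast
qed

lemma Dbeta_orbit:
  assumes "5 - 3 * sqrt 2 < a" "a < 2 * sqrt 2 - 2"
  defines "p \<equiv> (a, 2 - sqrt 2 * a)"
  shows "p \<in> Dset" "That p = (2 - sqrt 2 * a, 3 - 2 * sqrt 2 + a)"
    "(That ^^ 2) p = (3 - 2 * sqrt 2 + a, 5 - 3 * sqrt 2)"
    "(That ^^ 3) p = (5 - 3 * sqrt 2, 6 - 3 * sqrt 2 - a)"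
    "(That ^^ 4) p = (6 - 3 * sqrt 2 - a, 4 - 3 * sqrt 2 + sqrt 2 * a)"
    "(That ^^ 5) p = (4 - 3 * sqrt 2 + sqrt 2 * a, 3 - sqrt 2 - a)"
    "(That ^^ 6) p = (3 - sqrt 2 - a, 2 - sqrt 2 * (3 - sqrt 2 - a))"
    "j < 5 \<Longrightarrow> part ((That ^^ j) p) = Above" "part ((That ^^ 5) p) = On"
proof -
  have "sqrt 2 * a < sqrt 2 * (2 * sqrt 2 - 2)" "sqrt 2 * a > sqrt 2 * (5 - 3 * sqrt 2)"
    using assms by (simp_all only: sqrt2_cancel_less)
  then have a: "sqrt 2 * a < 4 - 2 * sqrt 2" "sqrt 2 * a > 5 * sqrt 2 - 6"
    "5 - 3 * sqrt 2 < a" "a < 2 * sqrt 2 - 2"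
    using assms by (simp_all add: algebra_simps sqrt2_mult)
  note b = this sqrt2_bounds
  have D0: "p \<in> Dset" and A0: "a + sqrt 2 * (2 - sqrt 2 * a) > 2"
  proof -
    show "a + sqrt 2 * (2 - sqrt 2 * a) > 2"
      using b unfolding right_diff_distrib sqrt2_mult by linarith
    then show "p \<in> Dset"
      unfolding p_def Dset_iff using b by (intro conjI disjI2) linarith+
  qed
  then show "p \<in> Dset" by simp
  show 1: "That p = (2 - sqrt 2 * a, 3 - 2 * sqrt 2 + a)"
    using D0 A0 by (simp add: p_def That_above) (simp add: algebra_simps sqrt2_mult)
  have D1: "(2 - sqrt 2 * a, 3 - 2 * sqrt 2 + a) \<in> Dset"
    using That_in_Dset[OF D0] 1 by simp
  have A1: "2 - sqrt 2 * a + sqrt 2 * (3 - 2 * sqrt 2 + a) > 2"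
    using b unfolding right_diff_distrib distrib_left sqrt2_mult by linarith
  have 2: "That (2 - sqrt 2 * a, 3 - 2 * sqrt 2 + a) = (3 - 2 * sqrt 2 + a, 5 - 3 * sqrt 2)"
    using D1 A1 by (simp add: That_above) (simp add: algebra_simps sqrt2_mult)
  have D2: "(3 - 2 * sqrt 2 + a, 5 - 3 * sqrt 2) \<in> Dset"
    using That_in_Dset[OF D1] 2 by simp
  have A2: "3 - 2 * sqrt 2 + a + sqrt 2 * (5 - 3 * sqrt 2) > 2"
    using b unfolding right_diff_distrib distrib_left sqrt2_mult by linarith
  have 3: "That (3 - 2 * sqrt 2 + a, 5 - 3 * sqrt 2) = (5 - 3 * sqrt 2, 6 - 3 * sqrt 2 - a)"
    using D2 A2 by (simp add: That_above) (simp add: algebra_simps sqrt2_mult)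
  have D3: "(5 - 3 * sqrt 2, 6 - 3 * sqrt 2 - a) \<in> Dset"
    using That_in_Dset[OF D2] 3 by simp
  have A3: "5 - 3 * sqrt 2 + sqrt 2 * (6 - 3 * sqrt 2 - a) > 2"
    using b unfolding right_diff_distrib distrib_left sqrt2_mult by linarith
  have 4: "That (5 - 3 * sqrt 2, 6 - 3 * sqrt 2 - a) = (6 - 3 * sqrt 2 - a, 4 - 3 * sqrt 2 + sqrt 2 * a)"
    using D3 A3 by (simp add: That_above) (simp add: algebra_simps sqrt2_mult)
  have D4: "(6 - 3 * sqrt 2 - a, 4 - 3 * sqrt 2 + sqrt 2 * a) \<in> Dset"
    using That_in_Dset[OF D3] 4 by simp
  have A4: "6 - 3 * sqrt 2 - a + sqrt 2 * (4 - 3 * sqrt 2 + sqrt 2 * a) > 2"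
    using b unfolding right_diff_distrib distrib_left sqrt2_mult by linarith
  have 5: "That (6 - 3 * sqrt 2 - a, 4 - 3 * sqrt 2 + sqrt 2 * a)
      = (4 - 3 * sqrt 2 + sqrt 2 * a, 3 - sqrt 2 - a)"
    using D4 A4 by (simp add: That_above) (simp add: algebra_simps sqrt2_mult)
  have D5: "(4 - 3 * sqrt 2 + sqrt 2 * a, 3 - sqrt 2 - a) \<in> Dset"
    using That_in_Dset[OF D4] 5 by simp
  have A5: "4 - 3 * sqrt 2 + sqrt 2 * a + sqrt 2 * (3 - sqrt 2 - a) = 2"
    by (simp add: algebra_simps sqrt2_mult)
  have 6: "That (4 - 3 * sqrt 2 + sqrt 2 * a, 3 - sqrt 2 - a)
      = (3 - sqrt 2 - a, 2 - sqrt 2 * (3 - sqrt 2 - a))"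
    using That_on[OF D5 A5] by (simp add: algebra_simps sqrt2_mult)
  show t2: "(That ^^ 2) p = (3 - 2 * sqrt 2 + a, 5 - 3 * sqrt 2)"
    by (simp add: numeral_2_eq_2 1 2)
  show t3: "(That ^^ 3) p = (5 - 3 * sqrt 2, 6 - 3 * sqrt 2 - a)"
    by (simp add: eval_nat_numeral 1 2 3)
  show t4: "(That ^^ 4) p = (6 - 3 * sqrt 2 - a, 4 - 3 * sqrt 2 + sqrt 2 * a)"
    by (simp add: eval_nat_numeral 1 2 3 4)
  show t5: "(That ^^ 5) p = (4 - 3 * sqrt 2 + sqrt 2 * a, 3 - sqrt 2 - a)"
    by (simp add: eval_nat_numeral 1 2 3 4 5)
  show "(That ^^ 6) p = (3 - sqrt 2 - a, 2 - sqrt 2 * (3 - sqrt 2 - a))"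
    by (simp add: eval_nat_numeral 1 2 3 4 5 6)
  show "part ((That ^^ 5) p) = On"
    unfolding t5 using A5 by (simp add: part_def)
  show "part ((That ^^ j) p) = Above" if "j < 5"
  proof -
    have "j = 0 \<or> j = 1 \<or> j = 2 \<or> j = 3 \<or> j = 4"
      using that by auto
    then show ?thesis
      using A0 A1 A2 A3 A4 by (auto simp: part_def t2 t3 t4 1) (auto simp: p_def)
  qed
qed

lemma Dbeta_memI: "5 - 3 * sqrt 2 < a \<Longrightarrow> a < 2 * sqrt 2 - 2 \<Longrightarrow> (a, 2 - sqrt 2 * a) \<in> Dbeta"
  by (auto simp: Dbeta_def)

lemma Dbeta_subset: "Dbeta \<subseteq> Dset"
  using Dbeta_orbit(1) by (auto simp: Dbeta_def)

text \<open>The sixth iterate of \<open>That\<close> reflects \<open>Dbeta\<close> in its midpoint.\<close>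

lemma That6_Dbeta:
  assumes "p \<in> Dbeta"
  shows "(That ^^ 6) p \<in> Dbeta" "fst ((That ^^ 6) p) = 3 - sqrt 2 - fst p" "(That ^^ 12) p = p"
proof -
  obtain a where a: "p = (a, 2 - sqrt 2 * a)" "5 - 3 * sqrt 2 < a" "a < 2 * sqrt 2 - 2"
    using assms by (auto simp: Dbeta_def)
  define a' where "a' = 3 - sqrt 2 - a"
  have a': "5 - 3 * sqrt 2 < a'" "a' < 2 * sqrt 2 - 2"
    using a by (auto simp: a'_def)
  have 6: "(That ^^ 6) p = (a', 2 - sqrt 2 * a')"
    using Dbeta_orbit(7)[of a] a by (simp add: a'_def)
  show "(That ^^ 6) p \<in> Dbeta" "fst ((That ^^ 6) p) = 3 - sqrt 2 - fst p"
    using 6 a a' by (auto simp: Dbeta_memI a'_def)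
  have "(That ^^ 12) p = (That ^^ 6) ((That ^^ 6) p)"
    by (simp flip: funpow_add comp_apply[of "That ^^ 6" "That ^^ 6"])
  also have "\<dots> = (3 - sqrt 2 - a', 2 - sqrt 2 * (3 - sqrt 2 - a'))"
    unfolding 6 using Dbeta_orbit(7)[OF a'] .
  finally show "(That ^^ 12) p = p"
    by (simp add: a'_def a)
qed

lemma That6_funpow_Dbeta: "p \<in> Dbeta \<Longrightarrow> (That ^^ (6 * q)) p \<in> Dbeta"
proof (induction q)
  case (Suc q)
  have "(That ^^ (6 * Suc q)) p = (That ^^ 6) ((That ^^ (6 * q)) p)"
    by (simp add: funpow_add)
  with Suc show ?case
    using That6_Dbeta(1) by simp
qed simp

lemma part_Dbeta:
  assumes "p \<in> Dbeta"
  shows "part ((That ^^ j) p) = (if j mod 6 = 5 then On else Above)"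
proof -
  define q where "q = (That ^^ (6 * (j div 6))) p"
  have "q \<in> Dbeta"
    using That6_funpow_Dbeta[OF assms] by (simp add: q_def)
  then obtain a where a: "q = (a, 2 - sqrt 2 * a)" "5 - 3 * sqrt 2 < a" "a < 2 * sqrt 2 - 2"
    by (auto simp: Dbeta_def)
  have "j = j mod 6 + 6 * (j div 6)"
    by simp
  then have "(That ^^ j) p = (That ^^ (j mod 6)) q"
    unfolding q_def by (metis comp_apply funpow_add)
  moreover have "j mod 6 < 5 \<or> j mod 6 = 5"
    using pos_mod_bound[of 6 j] by auto
  ultimately show ?thesis
    using Dbeta_orbit(8)[OF a(2,3), of "j mod 6"] Dbeta_orbit(9)[OF a(2,3)] by (auto simp: a(1))
qed

lemma orb_weight_Dbeta:
  assumes "p \<in> Dbeta"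
  shows "fst p = (3 - sqrt 2) / 2 \<Longrightarrow>
      orb_weight That (\<lambda>u. h (part u)) p = enat (5 * h Above + h On)"
    "fst p \<noteq> (3 - sqrt 2) / 2 \<Longrightarrow>
      orb_weight That (\<lambda>u. h (part u)) p = enat (2 * (5 * h Above + h On))"
proof -
  obtain a where a: "p = (a, 2 - sqrt 2 * a)" "5 - 3 * sqrt 2 < a" "a < 2 * sqrt 2 - 2"
    using assms by (auto simp: Dbeta_def)
  note orbit = Dbeta_orbit[OF a(2,3), folded a(1)]
  have p2: "(That ^^ 2) p \<noteq> p" and p3: "(That ^^ 3) p \<noteq> p" and p4: "(That ^^ 4) p \<noteq> p"
    unfolding orbit using a sqrt2_bounds by auto
  show "orb_weight That (\<lambda>u. h (part u)) p = enat (5 * h Above + h On)"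
    if mid: "fst p = (3 - sqrt 2) / 2"
  proof -
    have "(That ^^ 6) p = p"
    proof -
      have "3 - sqrt 2 - a = a"
        using mid a(1) by simp
      then show ?thesis
        unfolding orbit by (simp add: a(1))
    qed
    moreover have "(That ^^ d) p \<noteq> p" if "0 < d" "d < 6" for d
    proof (rule minimal_period_criterion[where f = That and p = 6])
      fix q :: nat assume "prime q" "q dvd 6"
      then have "q = 2 \<or> q = 3"
        using prime_dvd_mult_iff[of q 2 3] primes_dvd_imp_eq[of q 2] primes_dvd_imp_eq[of q 3] by auto
      then show "(That ^^ (6 div q)) p \<noteq> p"
        using p2 p3 by auto
    qed (use \<open>(That ^^ 6) p = p\<close> that in auto)
    ultimately have "orb_weight That (\<lambda>u. h (part u)) p = enat (\<Sum>j<6. h (part ((That ^^ j) p)))"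
      using orbit(1) by (intro That.orb_weight_periodic) auto
    then show ?thesis
      by (simp add: part_Dbeta[OF assms] lessThan_nat_numeral)
  qed
  show "orb_weight That (\<lambda>u. h (part u)) p = enat (2 * (5 * h Above + h On))"
    if mid: "fst p \<noteq> (3 - sqrt 2) / 2"
  proof -
    have p6: "(That ^^ 6) p \<noteq> p"
      unfolding orbit using mid a by (auto simp: field_simps)
    have "(That ^^ d) p \<noteq> p" if "0 < d" "d < 12" for d
    proof (rule minimal_period_criterion[where f = That and p = 12])
      fix q :: nat assume "prime q" "q dvd 12"
      then have "q = 2 \<or> q = 3"
        using prime_dvd_mult_iff[of q 2 6] prime_dvd_mult_iff[of q 2 3]
          primes_dvd_imp_eq[of q 2] primes_dvd_imp_eq[of q 3] by auto
      then show "(That ^^ (12 div q)) p \<noteq> p"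
        using p4 p6 by auto
    qed (use That6_Dbeta(3)[OF assms] that in auto)
    then have "orb_weight That (\<lambda>u. h (part u)) p = enat (\<Sum>j<12. h (part ((That ^^ j) p)))"
      using orbit(1) That6_Dbeta(3)[OF assms] by (intro That.orb_weight_periodic) auto
    then show ?thesis
      by (simp add: part_Dbeta[OF assms] lessThan_nat_numeral)
  qed
qed

lemma exceptional_orbit:
  defines "p \<equiv> (8 - 5 * sqrt 2, 8 - 5 * sqrt 2)"
  shows "p \<in> Dset" "That p = (8 - 5 * sqrt 2, 5 - 3 * sqrt 2)"
    "(That ^^ 2) p = (5 - 3 * sqrt 2, 8 - 5 * sqrt 2)" "(That ^^ 3) p = p"
    "orb_weight That (\<lambda>u. h (part u)) p = enat (2 * h Above + h On)"
proof -
  note b = sqrt2_bounds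
  have A0: "8 - 5 * sqrt 2 + sqrt 2 * (8 - 5 * sqrt 2) > 2"
    using b unfolding right_diff_distrib sqrt2_mult by (simp add: sqrt2_mult)
  then show D0: "p \<in> Dset"
    unfolding p_def Dset_iff using b by (intro conjI disjI2) linarith+
  show 1: "That p = (8 - 5 * sqrt 2, 5 - 3 * sqrt 2)"
    using D0 A0 by (simp add: p_def That_above) (simp add: algebra_simps sqrt2_mult)
  have D1: "(8 - 5 * sqrt 2, 5 - 3 * sqrt 2) \<in> Dset"
    using That_in_Dset[OF D0] 1 by simp
  have A1: "8 - 5 * sqrt 2 + sqrt 2 * (5 - 3 * sqrt 2) = 2"
    by (simp add: algebra_simps sqrt2_mult)
  have 2: "That (8 - 5 * sqrt 2, 5 - 3 * sqrt 2) = (5 - 3 * sqrt 2, 8 - 5 * sqrt 2)"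
    using That_on[OF D1 A1] .
  have D2: "(5 - 3 * sqrt 2, 8 - 5 * sqrt 2) \<in> Dset"
    using That_in_Dset[OF D1] 2 by simp
  have A2: "5 - 3 * sqrt 2 + sqrt 2 * (8 - 5 * sqrt 2) > 2"
    using b by (simp add: algebra_simps sqrt2_mult)
  have 3: "That (5 - 3 * sqrt 2, 8 - 5 * sqrt 2) = p"
    using D2 A2 by (simp add: That_above p_def) (simp add: algebra_simps sqrt2_mult)
  show t2: "(That ^^ 2) p = (5 - 3 * sqrt 2, 8 - 5 * sqrt 2)"
    by (simp add: numeral_2_eq_2 1 2)
  show t3: "(That ^^ 3) p = p"
    by (simp add: numeral_3_eq_3 1 2 3)
  have "(That ^^ d) p \<noteq> p" if "0 < d" "d < 3" for d
  proof -
    have "d = 1 \<or> d = 2"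
      using that by auto
    then show ?thesis
      using 1 t2 b by (auto simp: p_def)
  qed
  then have "orb_weight That (\<lambda>u. h (part u)) p = enat (\<Sum>j<3. h (part ((That ^^ j) p)))"
    using D0 t3 by (intro That.orb_weight_periodic) auto
  then show "orb_weight That (\<lambda>u. h (part u)) p = enat (2 * h Above + h On)"
    using A0 A1 A2 by (simp add: numeral_3_eq_3 1 2 part_def) (simp add: p_def)
qed

text \<open>An orbit that stays above the line forever is an orbit of the affine rotation of order 8 about
  the fixed point of \<open>Tmap\<close> in \<open>Dset\<close>.\<close>

lemma always_above_rotation:
  assumes w: "(x, y) \<in> Dset" and above: "\<And>n. part ((That ^^ n) (x, y)) = Above"
  shows "(That ^^ n) (x, y) = (Tmap ^^ n) (x, y)"
    "Tmap ((Tmap ^^ n) (x, y)) = timesA ((Tmap ^^ n) (x, y)) + (0, 3)"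
    "(Tmap ^^ 4) (x, y) = (6 - 3 * sqrt 2 - x, 6 - 3 * sqrt 2 - y)"
    "(Tmap ^^ 8) (x, y) = (x, y)"
proof -
  have step: "That u = Tmap u \<and> Tmap u = timesA u + (0, 3)" if "u \<in> Dset" "part u = Above" for u
    using that That_above Tmap_above Dset_subset
    by (cases u) (auto simp: part_def timesA_def split: if_splits)
  show eq: "(That ^^ n) (x, y) = (Tmap ^^ n) (x, y)" for n
  proof (induction n)
    case (Suc n)
    then show ?case
      using step[OF That.funpow_in[OF w] above, of n] by simp
  qed simp
  show lin: "Tmap ((Tmap ^^ n) (x, y)) = timesA ((Tmap ^^ n) (x, y)) + (0, 3)" for n
    using step[of "(That ^^ n) (x, y)"] above That.funpow_in[OF w] eq by simp
  have four: "(Tmap ^^ (n + 4)) (x, y) = (6 - 3 * sqrt 2 - u, 6 - 3 * sqrt 2 - v)"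
    if "(Tmap ^^ n) (x, y) = (u, v)" for n u v
    using that lin[of n] lin[of "Suc n"] lin[of "Suc (Suc n)"] lin[of "Suc (Suc (Suc n))"]
    by (simp add: eval_nat_numeral timesA_def algebra_simps sqrt2_mult)
  show "(Tmap ^^ 4) (x, y) = (6 - 3 * sqrt 2 - x, 6 - 3 * sqrt 2 - y)"
    using four[of 0] by simp
  then show "(Tmap ^^ 8) (x, y) = (x, y)"
    using four[of 4] by simp
qed

lemma int_iter_Tmap_Suc:
  assumes "z \<in> unit_sq"
  shows "int_iter unit_sq Tmap (k + 1) z = Tmap (int_iter unit_sq Tmap k z)"
proof (cases "0 \<le> k")
  case True
  then show ?thesis
    by (simp add: int_iter_def nat_add_distrib)
next
  case False
  define n where "n = nat (- k - 1)"
  have k: "k = - int (Suc n)"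
    using False by (simp add: n_def)
  have "(inv_into unit_sq Tmap ^^ n) z \<in> unit_sq" for n
    by (induction n) (use assms bij_betw_Tmap in \<open>auto simp: bij_betw_def inv_into_into\<close>)
  then have "Tmap ((inv_into unit_sq Tmap ^^ Suc n) z) = (inv_into unit_sq Tmap ^^ n) z"
    using bij_betw_Tmap by (simp add: bij_betw_def f_inv_into_f)
  then show ?thesis
    by (cases "n = 0") (auto simp: int_iter_def k nat_add_distrib)
qed

lemma always_above_imp_Dalpha:
  assumes w: "w \<in> Dset" and above: "\<And>n. part ((That ^^ n) w) = Above"
  shows "w \<in> Dalpha"
proof -
  have unit: "w \<in> unit_sq"
    using w Dset_subset by auto
  have rot: "(Tmap ^^ 8) w = w" "Tmap ((Tmap ^^ n) w) = timesA ((Tmap ^^ n) w) + (0, 3)" for n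
    using always_above_rotation[of "fst w" "snd w"] w above by auto
  have "\<exists>m. int_iter unit_sq Tmap k w = (Tmap ^^ m) w" for k
  proof (cases "0 \<le> k")
    case False
    have "\<exists>m. (inv_into unit_sq Tmap ^^ n) w = (Tmap ^^ m) w" for n
    proof (induction n)
      case 0
      show ?case by (rule exI[of _ 0]) simp
    next
      case (Suc n)
      then obtain m where m: "(inv_into unit_sq Tmap ^^ n) w = (Tmap ^^ m) w" by blast
      have "(Tmap ^^ m) w = (Tmap ^^ (m + 8)) w"
        using rot(1) by (simp add: funpow_add)
      also have "\<dots> = Tmap ((Tmap ^^ (m + 7)) w)"
        by (simp add: eval_nat_numeral)
      finally show ?case
        using m T.inj T.funpow_in[OF unit] by (auto simp: inv_into_f_f)
    qed
    with False show ?thesis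
      by (simp add: int_iter_def)
  qed (auto simp: int_iter_def)
  then have "int_iter unit_sq Tmap (k + 1) w = timesA (int_iter unit_sq Tmap k w) + (0, 3)" for k
    using int_iter_Tmap_Suc[OF unit] rot(2) by metis
  then show ?thesis
    using unit by (simp add: Dalpha_def)
qed

lemma Dalpha_always_above:
  assumes "w \<in> Dalpha"
  shows "w \<in> Dset" "part ((That ^^ n) w) = Above"
proof -
  have unit: "w \<in> unit_sq"
    using assms by (simp add: Dalpha_def)
  have lin: "Tmap ((Tmap ^^ n) w) = timesA ((Tmap ^^ n) w) + (0, 3)" for n
  proof -
    have "int_iter unit_sq Tmap (int n + 1) w = timesA (int_iter unit_sq Tmap (int n) w) + (0, 3)"
      using assms by (simp add: Dalpha_def)
    then show ?thesis
      by (simp add: int_iter_def nat_add_distrib)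
  qed
  have above: "(Tmap ^^ n) w \<in> Dset \<and> part ((Tmap ^^ n) w) = Above" for n
  proof -
    obtain x y where xy: "(Tmap ^^ n) w = (x, y)" by (cases "(Tmap ^^ n) w")
    have "(x, y) \<in> unit_sq" "Tmap (x, y) \<in> unit_sq"
      using T.funpow_in[OF unit, of n] T.funpow_in[OF unit, of "Suc n"] xy by auto
    moreover have "Tmap (x, y) = (y, 3 - x - sqrt 2 * y)"
      using lin[of n] unfolding xy by (simp add: timesA_def)
    ultimately have "x + sqrt 2 * y > 2" "(x, y) \<in> unit_sq"
      by (auto simp: unit_sq_def)
    then show ?thesis
      unfolding xy by (auto simp: Dset_def part_def)
  qed
  have "(That ^^ n) w = (Tmap ^^ n) w" for n
  proof (induction n)
    case (Suc n)
    obtain x y where "(Tmap ^^ n) w = (x, y)" by (cases "(Tmap ^^ n) w")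
    with Suc above[of n] Dset_subset show ?case
      by (auto simp: That_eq_return_point part_def Tmap_above split: if_splits)
  qed simp
  with above show "w \<in> Dset" "part ((That ^^ n) w) = Above"
    using above[of 0] by auto
qed

lemma orb_weight_Dalpha:
  assumes "w \<in> Dalpha"
  defines "c \<equiv> (3 - 3 / sqrt 2, 3 - 3 / sqrt 2)"
  shows "w = c \<Longrightarrow> orb_weight That (\<lambda>u. h (part u)) w = enat (h Above)"
    "w \<noteq> c \<Longrightarrow> orb_weight That (\<lambda>u. h (part u)) w = enat (8 * h Above)"
proof -
  note above = Dalpha_always_above[OF assms(1)]
  obtain x y where w: "w = (x, y)" by (cases w)
  note rot = always_above_rotation[OF above[unfolded w], folded w]
  have c: "3 - 3 / sqrt 2 = (6 - 3 * sqrt 2) / 2"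
    by (simp add: field_simps)
  show "orb_weight That (\<lambda>u. h (part u)) w = enat (h Above)" if "w = c"
  proof -
    have "That w = w"
      using rot(1)[of 1] rot(2)[of 0] that
      by (simp add: c_def c timesA_def) (simp add: field_simps)
    then have "orb_weight That (\<lambda>u. h (part u)) w = enat (\<Sum>j<1. h (part ((That ^^ j) w)))"
      using above(1) by (intro That.orb_weight_periodic) auto
    then show ?thesis
      using above(2)[of 0] by simp
  qed
  show "orb_weight That (\<lambda>u. h (part u)) w = enat (8 * h Above)" if "w \<noteq> c"
  proof -
    have four: "(That ^^ 4) w \<noteq> w"
      using rot(1)[of 4] rot(3) that by (auto simp: w c_def c)
    have "(That ^^ d) w \<noteq> w" if "0 < d" "d < 8" for d
    proof (rule minimal_period_criterion[where f = That and p = 8])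
      fix q :: nat assume "prime q" "q dvd 8"
      then have "q = 2"
        using prime_dvd_power[of q 2 3] primes_dvd_imp_eq[of q 2] by auto
      then show "(That ^^ (8 div q)) w \<noteq> w"
        using four by simp
    qed (use rot(1)[of 8] rot(4) that w in auto)
    then have "orb_weight That (\<lambda>u. h (part u)) w = enat (\<Sum>j<8. h (part ((That ^^ j) w)))"
      using above(1) rot(1)[of 8] rot(4) w by (intro That.orb_weight_periodic) auto
    then show ?thesis
      by (simp add: above(2))
  qed
qed

text \<open>A point whose forward orbit meets \<open>Dbeta\<close> or the exceptional orbit of length 3 lies itself on the
  cycle that it reaches, since \<open>That\<close> is injective.\<close>

lemma Pset_subset:
  assumes "w \<in> Pset"
  shows "w \<in> Dalpha \<or> w \<in> (\<Union>m\<in>{0..5}. (That ^^ m) ` Dbeta) \<or>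
    (\<exists>m\<in>{0..2}. w = (That ^^ m) (8 - 5 * sqrt 2, 8 - 5 * sqrt 2))"
proof -
  have w: "w \<in> Dset"
    using assms by (simp add: Pset_def)
  have avoid: "(That ^^ n) w \<notin> Vmap ` Dset" for n
  proof -
    have "int_iter Dset That (int n) w \<notin> Umap ` Dset"
      using assms by (simp add: Pset_def)
    then show ?thesis
      by (simp add: int_iter_def Vmap_image)
  qed
  show ?thesis
  proof (cases "\<forall>n. part ((That ^^ n) w) = Above")
    case True
    then show ?thesis
      using always_above_imp_Dalpha[OF w] by simp
  next
    case False
    then obtain n where n: "part ((That ^^ n) w) \<noteq> Above" by blast
    define v where "v = (That ^^ n) w"
    have v: "v \<in> Dset" "That (That v) \<notin> Vmap ` Dset"
      using That.funpow_in[OF w] avoid[of "Suc (Suc n)"] by (auto simp: v_def)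
    then have "part v = On"
      using That_avoiding_not_below n by (cases "part v") (auto simp: v_def)
    then obtain a where a: "That v = (a, 2 - sqrt 2 * a)" "5 - 3 * sqrt 2 \<le> a" "a < 2 * sqrt 2 - 2"
      using That_avoiding_on v by blast
    have reach: "(That ^^ Suc n) w = (a, 2 - sqrt 2 * a)"
      using a(1) by (simp add: v_def)
    show ?thesis
    proof (cases "a = 5 - 3 * sqrt 2")
      case True
      define p where "p = (8 - 5 * sqrt 2, 8 - 5 * sqrt 2)"
      have "2 - sqrt 2 * a = 8 - 5 * sqrt 2"
        unfolding True by (simp add: algebra_simps sqrt2_mult)
      then have p: "p \<in> Dset" "(That ^^ 3) p = p" "(That ^^ 2) p = (a, 2 - sqrt 2 * a)"
        unfolding p_def True using exceptional_orbit(1,3,4) by simp_all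
      then have "(That ^^ Suc (Suc n)) w = p"
        using reach by (simp add: eval_nat_numeral)
      then obtain m where m: "w = (That ^^ m) p"
        using That.periodic_pull_back[of w p "Suc (Suc n)" 3] w p by (metis zero_less_numeral)
      have "w = (That ^^ (m mod 3)) p"
        unfolding funpow_mod_eq[OF p(2)] by (rule m)
      moreover have "m mod 3 \<in> {0..2}"
        using mod_less_divisor[of 3 m] by simp
      ultimately show ?thesis
        unfolding p_def by blast
    next
      case False
      define p where "p = (a, 2 - sqrt 2 * a)"
      have p: "p \<in> Dbeta"
        using False a by (auto simp: p_def intro: Dbeta_memI)
      then obtain m where "w = (That ^^ m) p"
        using That.periodic_pull_back[OF w _ _ That6_Dbeta(3)[OF p], of "Suc n"] Dbeta_subset reach
        unfolding p_def[symmetric] by (metis subsetD zero_less_numeral)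
      also have "\<dots> = (That ^^ (m mod 6 + 6 * (m div 6))) p"
        by simp
      finally have "w = (That ^^ (m mod 6)) ((That ^^ (6 * (m div 6))) p)"
        unfolding funpow_add by simp
      moreover have "m mod 6 \<in> {0..5}"
        using mod_less_divisor[of 6 m] by simp
      ultimately show ?thesis
        using That6_funpow_Dbeta[OF p] by blast
    qed
  qed
qed

section \<open>Orbits that never meet the induction domain\<close>

text \<open>The first coordinates of the points of an orbit that avoids \<open>Dset\<close> and the origin, with the
  integers added, as real numbers.\<close>

definition coded :: "(nat \<Rightarrow> real) \<Rightarrow> (nat \<Rightarrow> real) \<Rightarrow> bool" where
  "coded X K \<longleftrightarrow> (\<forall>n. 0 \<le> X n \<and> X n < 1 \<and> K n \<in> {1, 2} \<and> X n + sqrt 2 * X (n + 1) + X (n + 2) = K n)"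

lemma Rset_coded:
  assumes z: "z \<in> Rset" "z \<noteq> (0, 0)"
  obtains X K where "coded X K" "\<And>n. (Tmap ^^ n) z = (X n, X (n + 1))"
proof -
  have unit: "z \<in> unit_sq"
    using z by (simp add: Rset_def)
  define X where "X = (\<lambda>n. fst ((Tmap ^^ n) z))"
  define K where "K = (\<lambda>n. X n + sqrt 2 * X (n + 1) + X (n + 2))"
  have snd: "snd ((Tmap ^^ n) z) = X (Suc n)" for n
    by (cases "(Tmap ^^ n) z") (simp add: X_def Tmap_def)
  then have T: "(Tmap ^^ n) z = (X n, X (n + 1))" for n
    by (metis X_def Suc_eq_plus1 prod.collapse)
  have X: "0 \<le> X n" "X n < 1" for n
    using T.funpow_in[OF unit, of n] unfolding T by (auto simp: unit_sq_def)
  have "K n \<in> {1, 2}" for n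
  proof -
    have "Tmap (X n, X (n + 1)) = (X (n + 1), X (n + 2))"
      using T[of n] T[of "Suc n"] by simp
    then have K: "K n = of_int \<lceil>X n + sqrt 2 * X (n + 1)\<rceil>"
      unfolding Tmap_eq_timesA K_def timesA_def by (auto simp: algebra_simps)
    have "(Tmap ^^ n) z \<notin> Dset"
      using z by (simp add: Rset_def)
    then have le: "X n + sqrt 2 * X (n + 1) \<le> 2"
      using X by (force simp: T Dset_iff)
    have "X n \<noteq> 0 \<or> X (n + 1) \<noteq> 0"
    proof (rule ccontr)
      assume "\<not> ?thesis"
      then have "(Tmap ^^ n) z = (0, 0)"
        by (simp add: T)
      moreover have "(Tmap ^^ n) (0, 0) = (0, 0)"
        by (induction n) (auto simp: Tmap_def)
      ultimately show False
        using T.funpow_inj[OF unit, of "(0, 0)" n] z(2) by (auto simp: unit_sq_def)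
    qed
    then have "0 < X n \<or> 0 < sqrt 2 * X (n + 1)" "0 \<le> sqrt 2 * X (n + 1)"
      using X[of n] X[of "n + 1"] by (auto simp: less_le)
    then have "0 < X n + sqrt 2 * X (n + 1)"
      using X[of n] by linarith
    with le have "\<lceil>X n + sqrt 2 * X (n + 1)\<rceil> = 1 \<or> \<lceil>X n + sqrt 2 * X (n + 1)\<rceil> = 2"
      by linarith
    with K show ?thesis by auto
  qed
  then have "coded X K"
    using X by (auto simp: coded_def K_def)
  with that T show ?thesis by blast
qed

context
  fixes X K :: "nat \<Rightarrow> real"
  assumes coded: "coded X K"
begin

lemma K_cases: "K n = 1 \<or> K n = 2"
  using coded by (auto simp: coded_def)

lemma relation: "X n + sqrt 2 * X (n + 1) + X (n + 2) = K n"
  using coded by (simp add: coded_def)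

text \<open>Eliminating the coordinates in between relates distant coordinates.  The linear part of \<open>Tmap\<close>
  has the characteristic polynomial \<open>t\<^sup>2 + sqrt 2 * t + 1\<close>, which divides \<open>t\<^sup>4 + 1\<close>,
  \<open>t\<^sup>6 - sqrt 2 * t\<^sup>3 + 1\<close>, \<open>sqrt 2 * t\<^sup>7 - t\<^sup>2 + 1\<close>, \<open>t\<^sup>7 - t\<^sup>5 + sqrt 2\<close> and \<open>t\<^sup>8 - 1\<close>.\<close>

lemma distant_relations:
  "X n + X (n + 4) = K n - sqrt 2 * K (n + 1) + K (n + 2)"
  "X n - sqrt 2 * X (n + 3) + X (n + 6) =
    K n - sqrt 2 * K (n + 1) + K (n + 2) - sqrt 2 * K (n + 3) + K (n + 4)"
  "X n - X (n + 2) + sqrt 2 * X (n + 7) =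
    K n - sqrt 2 * K (n + 1) + sqrt 2 * K (n + 3) - 2 * K (n + 4) + sqrt 2 * K (n + 5)"
  "sqrt 2 * X n - X (n + 5) + X (n + 7) =
    sqrt 2 * K n - 2 * K (n + 1) + sqrt 2 * K (n + 2) - sqrt 2 * K (n + 4) + K (n + 5)"
  "X (n + 8) - X n =
    K (n + 4) - sqrt 2 * K (n + 5) + K (n + 6) - K n + sqrt 2 * K (n + 1) - K (n + 2)"
  unfolding relation[symmetric] by (simp_all add: algebra_simps sqrt2_mult eval_nat_numeral)

lemma periodic_8:
  assumes "\<And>i. K (m + i + 4) = K (m + i)"
  shows "X (m + 8) = X m" "X (m + 9) = X (m + 1)"
proof -
  have K: "K (m + 4) = K m" "K (m + 5) = K (m + 1)" "K (m + 6) = K (m + 2)" "K (m + 7) = K (m + 3)"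
    using assms[of 0] assms[of 1] assms[of 2] assms[of 3] by (simp_all add: ac_simps)
  show "X (m + 8) = X m"
    using distant_relations(5)[of m] K by simp
  show "X (m + 9) = X (m + 1)"
    using distant_relations(5)[of "m + 1"] K by (simp add: ac_simps numeral_3_eq_3)
qed

lemma bounds: "0 \<le> X n" "X n < 1" "0 \<le> sqrt 2 * X n" "sqrt 2 * X n < sqrt 2"
  using coded by (auto simp: coded_def)

text \<open>Words of integers that contradict the bounds \<open>0 \<le> X i < 1\<close> in one of the relations.  The words of
  length 7 would imply \<open>\<bar>X (n + 8) - X n\<bar> = 1\<close>.\<close>

lemma forbidden_121:
  "K n = 1 \<Longrightarrow> K (n + 1) = 2 \<Longrightarrow> K (n + 2) = 1 \<Longrightarrow> False"
  using distant_relations(1)[of n] bounds[of n] bounds[of "n + 4"] sqrt2_bounds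
  by (simp only:)

lemma forbidden_212:
  "K n = 2 \<Longrightarrow> K (n + 1) = 1 \<Longrightarrow> K (n + 2) = 2 \<Longrightarrow> False"
  using distant_relations(1)[of n] bounds[of n] bounds[of "n + 4"] sqrt2_bounds
  by (simp only:)

lemma forbidden_12221:
  "K n = 1 \<Longrightarrow> K (n + 1) = 2 \<Longrightarrow> K (n + 2) = 2 \<Longrightarrow>
    K (n + 3) = 2 \<Longrightarrow> K (n + 4) = 1 \<Longrightarrow> False"
  using distant_relations(2)[of n] bounds[of n] bounds[of "n + 3"] bounds[of "n + 6"] sqrt2_bounds
  by (simp only:)

lemma forbidden_21112:
  "K n = 2 \<Longrightarrow> K (n + 1) = 1 \<Longrightarrow> K (n + 2) = 1 \<Longrightarrow>
    K (n + 3) = 1 \<Longrightarrow> K (n + 4) = 2 \<Longrightarrow> False"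
  using distant_relations(2)[of n] bounds[of n] bounds[of "n + 3"] bounds[of "n + 6"] sqrt2_bounds
  by (simp only:)

lemma forbidden_122221:
  "K n = 1 \<Longrightarrow> K (n + 1) = 2 \<Longrightarrow> K (n + 2) = 2 \<Longrightarrow>
    K (n + 3) = 2 \<Longrightarrow> K (n + 4) = 2 \<Longrightarrow> K (n + 5) = 1 \<Longrightarrow>
    False"
  using distant_relations(3)[of n] bounds[of n] bounds[of "n + 2"] bounds[of "n + 7"] sqrt2_bounds
  by (simp only:)

lemma forbidden_211112:
  "K n = 2 \<Longrightarrow> K (n + 1) = 1 \<Longrightarrow> K (n + 2) = 1 \<Longrightarrow>
    K (n + 3) = 1 \<Longrightarrow> K (n + 4) = 1 \<Longrightarrow> K (n + 5) = 2 \<Longrightarrow>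
    False"
  using distant_relations(3)[of n] bounds[of n] bounds[of "n + 2"] bounds[of "n + 7"] sqrt2_bounds
  by (simp only:)

lemma forbidden_122111:
  "K n = 1 \<Longrightarrow> K (n + 1) = 2 \<Longrightarrow> K (n + 2) = 2 \<Longrightarrow>
    K (n + 3) = 1 \<Longrightarrow> K (n + 4) = 1 \<Longrightarrow> K (n + 5) = 1 \<Longrightarrow>
    False"
  using distant_relations(3)[of n] bounds[of n] bounds[of "n + 2"] bounds[of "n + 7"] sqrt2_bounds
  by (simp only:)

lemma forbidden_111221:
  "K n = 1 \<Longrightarrow> K (n + 1) = 1 \<Longrightarrow> K (n + 2) = 1 \<Longrightarrow>
    K (n + 3) = 2 \<Longrightarrow> K (n + 4) = 2 \<Longrightarrow> K (n + 5) = 1 \<Longrightarrow>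
    False"
  using distant_relations(4)[of n] bounds[of n] bounds[of "n + 5"] bounds[of "n + 7"] sqrt2_bounds
  by (simp only:)

lemma forbidden_1222222:
  "K n = 1 \<Longrightarrow> K (n + 1) = 2 \<Longrightarrow> K (n + 2) = 2 \<Longrightarrow>
    K (n + 3) = 2 \<Longrightarrow> K (n + 4) = 2 \<Longrightarrow> K (n + 5) = 2 \<Longrightarrow>
    K (n + 6) = 2 \<Longrightarrow> False"
  using distant_relations(5)[of n] bounds[of n] bounds[of "n + 8"] sqrt2_bounds
  by (simp only:)

lemma forbidden_2111111:
  "K n = 2 \<Longrightarrow> K (n + 1) = 1 \<Longrightarrow> K (n + 2) = 1 \<Longrightarrow>
    K (n + 3) = 1 \<Longrightarrow> K (n + 4) = 1 \<Longrightarrow> K (n + 5) = 1 \<Longrightarrow>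
    K (n + 6) = 1 \<Longrightarrow> False"
  using distant_relations(5)[of n] bounds[of n] bounds[of "n + 8"] sqrt2_bounds
  by (simp only:)

lemma forbidden_2211222:
  "K n = 2 \<Longrightarrow> K (n + 1) = 2 \<Longrightarrow> K (n + 2) = 1 \<Longrightarrow>
    K (n + 3) = 1 \<Longrightarrow> K (n + 4) = 2 \<Longrightarrow> K (n + 5) = 2 \<Longrightarrow>
    K (n + 6) = 2 \<Longrightarrow> False"
  using distant_relations(5)[of n] bounds[of n] bounds[of "n + 8"] sqrt2_bounds
  by (simp only:)

lemma forbidden_2221122:
  "K n = 2 \<Longrightarrow> K (n + 1) = 2 \<Longrightarrow> K (n + 2) = 2 \<Longrightarrow>
    K (n + 3) = 1 \<Longrightarrow> K (n + 4) = 1 \<Longrightarrow> K (n + 5) = 2 \<Longrightarrow>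
    K (n + 6) = 2 \<Longrightarrow> False"
  using distant_relations(5)[of n] bounds[of n] bounds[of "n + 8"] sqrt2_bounds
  by (simp only:)

end

lemma coded_shift: "coded X K \<Longrightarrow> coded (\<lambda>i. X (n + i)) (\<lambda>i. K (n + i))"
  unfolding coded_def by (metis add.assoc)

text \<open>A step from \<open>1\<close> to \<open>2\<close> and the length of the block of twos that begins there determine
  everything that follows.\<close>

lemma word_1221_continues:
  assumes c: "coded X K" and K: "K 0 = 1" "K 1 = 2" "K 2 = 2" "K 3 = 1"
  shows "K 4 = 1 \<and> K 5 = 2 \<and> K 6 = 2 \<and> K 7 = 1"
proof -
  have 4: "K 4 = 1"
    using K_cases[OF c, of 4] forbidden_212[OF c, of 2] K by auto
  have 5: "K 5 = 2"
    using K_cases[OF c, of 5] forbidden_122111[OF c, of 0] K 4 by (auto simp: numeral_2_eq_2)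
  have 6: "K 6 = 2"
    using K_cases[OF c, of 6] forbidden_121[OF c, of 4] 4 5 by auto
  have 7: "K 7 = 1"
    using K_cases[OF c, of 7] forbidden_2211222[OF c, of 1] K 4 5 6
    by (auto simp: eval_nat_numeral)
  show ?thesis
    using 4 5 6 7 by simp
qed

lemma word_1222_continues:
  assumes c: "coded X K" and K: "K 0 = 1" "K 1 = 2" "K 2 = 2" "K 3 = 2"
  shows "K 4 = 2 \<and> K 5 = 2 \<and> K 6 = 1 \<and> K 7 = 1 \<and> K 8 = 1 \<and> K 9 = 1 \<and>
    K 10 = 1 \<and> K 11 = 2 \<and> K 12 = 2 \<and> K 13 = 2"
proof -
  have 4: "K 4 = 2"
    using K_cases[OF c, of 4] forbidden_12221[OF c, of 0] K by (auto simp: numeral_2_eq_2)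
  have 5: "K 5 = 2"
    using K_cases[OF c, of 5] forbidden_122221[OF c, of 0] K 4 by (auto simp: numeral_2_eq_2)
  have 6: "K 6 = 1"
    using K_cases[OF c, of 6] forbidden_1222222[OF c, of 0] K 4 5 by (auto simp: numeral_2_eq_2)
  have 7: "K 7 = 1"
    using K_cases[OF c, of 7] forbidden_212[OF c, of 5] 5 6 by auto
  have 8: "K 8 = 1"
    using K_cases[OF c, of 8] K_cases[OF c, of 9] forbidden_121[OF c, of 7]
      forbidden_2221122[OF c, of 3] K 4 5 6 7 by auto
  have 9: "K 9 = 1"
    using K_cases[OF c, of 9] forbidden_21112[OF c, of 5] 5 6 7 8 by auto
  have 10: "K 10 = 1"
    using K_cases[OF c, of 10] forbidden_211112[OF c, of 5] 5 6 7 8 9 by auto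
  have 11: "K 11 = 2"
    using K_cases[OF c, of 11] forbidden_2111111[OF c, of 5] 5 6 7 8 9 10 by auto
  have 12: "K 12 = 2"
    using K_cases[OF c, of 12] forbidden_121[OF c, of 10] 10 11 by auto
  have 13: "K 13 = 2"
    using K_cases[OF c, of 13] forbidden_111221[OF c, of 8] 8 9 10 11 12 by auto
  show ?thesis
    using 4 5 6 7 8 9 10 11 12 13 by simp
qed

lemma tail_1221:
  assumes c: "coded X K" and K: "K 0 = 1" "K 1 = 2" "K 2 = 2" "K 3 = 1"
  shows "K (i + 4) = K i"
proof -
  have block: "K (4 * q) = 1 \<and> K (4 * q + 1) = 2 \<and> K (4 * q + 2) = 2 \<and> K (4 * q + 3) = 1" for q
  proof (induction q)
    case (Suc q)
    then show ?case
      using word_1221_continues[OF coded_shift[OF c, of "4 * q"]] by (simp add: algebra_simps)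
  qed (use K in \<open>simp add: numeral_2_eq_2\<close>)
  define q r where "q = i div 4" and "r = i mod 4"
  have i: "i = 4 * q + r" "i + 4 = 4 * Suc q + r" and "r < 4"
    by (simp_all add: q_def r_def)
  then have "r = 0 \<or> r = 1 \<or> r = 2 \<or> r = 3"
    by auto
  then show ?thesis
    unfolding i(2) unfolding i(1) using block[of q] block[of "Suc q"] by auto
qed

text \<open>The periodic word with blocks of length 5 belongs to one orbit only, one point of which has the
  first coordinate \<open>0\<close>, the boundary value: the word forces \<open>X 0 + X 20 = 0\<close> and
  \<open>X 10 + X 30 = 0\<close>, hence \<open>X 0 = X 10 = 0\<close>, and these two equations determine the point.\<close>

lemma tail_1222:
  assumes c: "coded X K" and K: "K 0 = 1" "K 1 = 2" "K 2 = 2" "K 3 = 2"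
  shows "X 0 = 0" "X 1 = 1 - sqrt 2 / 2"
proof -
  note K0 = K word_1222_continues[OF c K]
  have K1: "K 14 = 2 \<and> K 15 = 2 \<and> K 16 = 1 \<and> K 17 = 1 \<and> K 18 = 1 \<and> K 19 = 1 \<and>
    K 20 = 1 \<and> K 21 = 2 \<and> K 22 = 2 \<and> K 23 = 2"
    using word_1222_continues[OF coded_shift[OF c, of 10]] K0 by simp
  have K2: "K 24 = 2 \<and> K 25 = 2 \<and> K 26 = 1 \<and> K 27 = 1 \<and> K 28 = 1 \<and> K 29 = 1"
    using word_1222_continues[OF coded_shift[OF c, of 20]] K1 by simp
  note rel = distant_relations(1)[OF c]
  have "X 0 + X 20 = 0"
    using rel[of 0] rel[of 4] rel[of 8] rel[of 12] rel[of 16] K0 K1 K2 by (simp add: numeral_2_eq_2)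
  then show X0: "X 0 = 0"
    using bounds(1)[OF c, of 0] bounds(1)[OF c, of 20] by linarith
  have "X 10 + X 30 = 0"
    using rel[of 10] rel[of 14] rel[of 18] rel[of 22] rel[of 26] K0 K1 K2 by simp
  then have "X 10 = 0"
    using bounds(1)[OF c, of 10] bounds(1)[OF c, of 30] by linarith
  then have "X 2 = 2 - sqrt 2"
    using rel[of 2] rel[of 6] K0 by simp
  then have "sqrt 2 * X 1 = sqrt 2 - 1"
    using relation[OF c, of 0] K0 X0 by (simp add: numeral_2_eq_2)
  then have "sqrt 2 * (sqrt 2 * X 1) = sqrt 2 * (sqrt 2 - 1)"
    by simp
  then show "X 1 = 1 - sqrt 2 / 2"
    by (simp add: algebra_simps sqrt2_mult)
qed

lemma coded_tail:
  assumes c: "coded X K"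
  shows "\<exists>n. X (n + 8) = X n \<and> X (n + 9) = X (n + 1) \<or> X n = 0 \<and> X (n + 1) = 1 - sqrt 2 / 2"
proof (cases "\<exists>n. K n = 1 \<and> K (n + 1) = 2")
  case True
  then obtain n where n: "K n = 1" "K (n + 1) = 2" by blast
  define X' K' where "X' = (\<lambda>i. X (n + i))" and "K' = (\<lambda>i. K (n + i))"
  have c': "coded X' K'"
    unfolding X'_def K'_def by (rule coded_shift[OF c])
  have K': "K' 0 = 1" "K' 1 = 2"
    using n by (simp_all add: K'_def)
  then have K'2: "K' 2 = 2"
    using K_cases[OF c', of 2] forbidden_121[OF c', of 0] by (auto simp: numeral_2_eq_2)
  show ?thesis
  proof (cases "K' 3 = 1")
    case True
    then have "X' (0 + 8) = X' 0" "X' (0 + 9) = X' (0 + 1)"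
      using periodic_8[OF c', of 0] tail_1221[OF c' K' K'2] by simp_all
    then show ?thesis
      by (auto simp: X'_def)
  next
    case False
    then have "K' 3 = 2"
      using K_cases[OF c', of 3] by auto
    then show ?thesis
      using tail_1222[OF c' K' K'2] by (auto simp: X'_def)
  qed
next
  case False
  have "\<exists>m. \<forall>i. K (m + i) = K m"
  proof (cases "\<exists>m. K m = 1")
    case True
    then obtain m where m: "K m = 1" by blast
    have "K (m + i) = 1" for i
    proof (induction i)
      case (Suc i)
      then have "K (m + i + 1) \<noteq> 2"
        using False by blast
      then show ?case
        using K_cases[OF c, of "m + i + 1"] by simp
    qed (use m in simp)
    with m show ?thesis
      by (intro exI[of _ m]) simp
  next
    case False
    then have "K i = 2" for i
      using K_cases[OF c, of i] by auto
    then show ?thesis by auto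
  qed
  then obtain m where "\<And>i. K (m + i) = K m" by blast
  then show ?thesis
    using periodic_8[OF c, of m] by (metis add.assoc)
qed

lemma orbit_10:
  shows "(1 / sqrt 2, 0) \<in> unit_sq" "Tmap (1 / sqrt 2, 0) = (0, 1 - sqrt 2 / 2)"
    "(Tmap ^^ 2) (1 / sqrt 2, 0) = (1 - sqrt 2 / 2, 2 - sqrt 2)"
    "(Tmap ^^ 5) (1 / sqrt 2, 0) = (3 - 2 * sqrt 2, 3 - 3 / 2 * sqrt 2)"
    "(Tmap ^^ 10) (1 / sqrt 2, 0) = (1 / sqrt 2, 0)"
proof -
  have half: "1 / sqrt 2 = sqrt 2 / 2"
    by (simp add: field_simps)
  let ?xs = "[sqrt 2 / 2, 0, 1 - sqrt 2 / 2, 2 - sqrt 2, 3 - 3 / 2 * sqrt 2, 3 - 2 * sqrt 2,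
      3 - 3 / 2 * sqrt 2, 2 - sqrt 2, 1 - sqrt 2 / 2, 0, sqrt 2 / 2, 0]"
  let ?ks = "[1, 1, 2, 2, 2, 2, 2, 1, 1, 1] :: int list"
  have it: "itinerary ?xs ?ks"
    using sqrt2_bounds unfolding itinerary.simps
    by (intro conjI; (linarith | simp add: algebra_simps sqrt2_mult))
  have *: "(Tmap ^^ j) (1 / sqrt 2, 0) = (?xs ! j, ?xs ! Suc j)" if "j \<le> 10" for j
    using itinerary_Tmap[OF it, of j] that unfolding half by simp
  show "(1 / sqrt 2, 0) \<in> unit_sq"
    unfolding half unit_sq_def using sqrt2_bounds by simp
  show "Tmap (1 / sqrt 2, 0) = (0, 1 - sqrt 2 / 2)"
    using *[of 1] by simp
  show "(Tmap ^^ 2) (1 / sqrt 2, 0) = (1 - sqrt 2 / 2, 2 - sqrt 2)"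
    using *[of 2] by simp
  show "(Tmap ^^ 5) (1 / sqrt 2, 0) = (3 - 2 * sqrt 2, 3 - 3 / 2 * sqrt 2)"
    using *[of 5] by simp
  show "(Tmap ^^ 10) (1 / sqrt 2, 0) = (1 / sqrt 2, 0)"
    using *[of 10] unfolding half by simp
qed

lemma orbit_4:
  defines "p \<equiv> (3 / 2 - sqrt 2, 3 / 2 - sqrt 2)"
  shows "p \<in> unit_sq" "Tmap p = (3 / 2 - sqrt 2, 3 / 2 - sqrt 2 / 2)"
    "(Tmap ^^ 2) p = (3 / 2 - sqrt 2 / 2, 3 / 2 - sqrt 2 / 2)"
    "(Tmap ^^ 3) p = (3 / 2 - sqrt 2 / 2, 3 / 2 - sqrt 2)" "(Tmap ^^ 4) p = p"
proof -
  let ?xs = "[3 / 2 - sqrt 2, 3 / 2 - sqrt 2, 3 / 2 - sqrt 2 / 2, 3 / 2 - sqrt 2 / 2,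
      3 / 2 - sqrt 2, 3 / 2 - sqrt 2]"
  let ?ks = "[1, 2, 2, 1] :: int list"
  have it: "itinerary ?xs ?ks"
    using sqrt2_bounds unfolding itinerary.simps
    by (intro conjI; (linarith | simp add: algebra_simps sqrt2_mult))
  have *: "(Tmap ^^ j) p = (?xs ! j, ?xs ! Suc j)" if "j \<le> 4" for j
    using itinerary_Tmap[OF it, of j] that unfolding p_def by simp
  show "p \<in> unit_sq"
    unfolding p_def unit_sq_def using sqrt2_bounds by simp
  show "Tmap p = (3 / 2 - sqrt 2, 3 / 2 - sqrt 2 / 2)"
    using *[of 1] by simp
  show "(Tmap ^^ 2) p = (3 / 2 - sqrt 2 / 2, 3 / 2 - sqrt 2 / 2)"
    using *[of 2] by simp
  show "(Tmap ^^ 3) p = (3 / 2 - sqrt 2 / 2, 3 / 2 - sqrt 2)"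
    using *[of 3] by simp
  show "(Tmap ^^ 4) p = p"
    using *[of 4] unfolding p_def by simp
qed

lemma Rset_period_8_or_orbit_10:
  assumes z: "z \<in> Rset"
  shows "(Tmap ^^ 8) z = z \<or> (\<exists>m\<in>{0..9}. z = (Tmap ^^ m) (1 / sqrt 2, 0))"
proof (cases "z = (0, 0)")
  case True
  have "(Tmap ^^ n) (0, 0) = (0, 0)" for n
    by (induction n) (auto simp: Tmap_def)
  with True show ?thesis by simp
next
  case False
  have unit: "z \<in> unit_sq"
    using z by (simp add: Rset_def)
  obtain X K where c: "coded X K" and T: "\<And>n. (Tmap ^^ n) z = (X n, X (n + 1))"
    using Rset_coded[OF z False] by metis
  obtain n where "X (n + 8) = X n \<and> X (n + 9) = X (n + 1) \<or> X n = 0 \<and> X (n + 1) = 1 - sqrt 2 / 2"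
    using coded_tail[OF c] by blast
  then show ?thesis
  proof
    assume "X (n + 8) = X n \<and> X (n + 9) = X (n + 1)"
    then have "(Tmap ^^ n) ((Tmap ^^ 8) z) = (Tmap ^^ n) z"
      using T[of n] T[of "n + 8"] by (simp add: funpow_add ac_simps)
    then show ?thesis
      using T.funpow_inj[of "(Tmap ^^ 8) z" z n] unit T.funpow_in by blast
  next
    assume X: "X n = 0 \<and> X (n + 1) = 1 - sqrt 2 / 2"
    define p where "p = (1 / sqrt 2, 0 :: real)"
    note p = orbit_10[folded p_def]
    have "(Tmap ^^ n) z = Tmap p"
      using T[of n] X p(2) by simp
    moreover have "(Tmap ^^ 10) (Tmap p) = Tmap p"
      using p(5) by (simp flip: funpow_swap1)
    ultimately obtain m where "z = (Tmap ^^ m) (Tmap p)"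
      using T.periodic_pull_back[of z "Tmap p" n 10] unit p(1) T.maps by (metis zero_less_numeral)
    then have "z = (Tmap ^^ Suc m) p"
      by (simp add: funpow_swap1)
    then have "z = (Tmap ^^ (Suc m mod 10)) p"
      unfolding funpow_mod_eq[OF p(5)] .
    moreover have "Suc m mod 10 \<in> {0..9}"
      using mod_less_divisor[of 10 "Suc m"] by simp
    ultimately show ?thesis
      unfolding p_def by blast
  qed
qed

text \<open>A point of period 4 has \<open>X (n + 4) = X n\<close>, so that the relation at distance 4 gives its coordinates
  in terms of its word; only the words \<open>1111\<close>, \<open>2222\<close> and \<open>1122\<close> survive, up to rotation.\<close>

lemma Rset_period_4:
  assumes z: "z \<in> Rset" and four: "(Tmap ^^ 4) z = z"
  shows "z \<in> {(0, 0), (1 - 1 / sqrt 2, 1 - 1 / sqrt 2), (2 - sqrt 2, 2 - sqrt 2)} \<or>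
    (\<exists>m\<in>{0..3}. z = (Tmap ^^ m) (3 / 2 - sqrt 2, 3 / 2 - sqrt 2))"
proof (cases "z = (0, 0)")
  case False
  obtain X K where c: "coded X K" and T: "\<And>n. (Tmap ^^ n) z = (X n, X (n + 1))"
    using Rset_coded[OF z False] by metis
  have X: "X (n + 4) = X n" for n
  proof -
    have "(Tmap ^^ (n + 4)) z = (Tmap ^^ n) z"
      using four by (simp add: funpow_add)
    then show ?thesis
      by (simp add: T)
  qed
  have X4: "X 4 = X 0" "X 5 = X 1" "X 6 = X 2" "X 7 = X 3"
    using X[of 0] X[of 1] X[of 2] X[of 3] by simp_all
  have K4: "K 4 = K 0" "K 5 = K 1"
    using relation[OF c, of 0] relation[OF c, of 1] relation[OF c, of 4] relation[OF c, of 5] X4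
    by (simp_all add: numeral_2_eq_2 numeral_3_eq_3)
  have X01: "2 * X 0 = K 0 - sqrt 2 * K 1 + K 2" "2 * X 1 = K 1 - sqrt 2 * K 2 + K 3"
    using distant_relations(1)[OF c, of 0] distant_relations(1)[OF c, of 1] X4
    by (simp_all add: numeral_2_eq_2 numeral_3_eq_3)
  have half: "1 / sqrt 2 = sqrt 2 / 2"
    by (simp add: field_simps)
  have z_eq: "z = (X 0, X 1)"
    using T[of 0] by simp
  have no: "\<not> (K 0 = a \<and> K 1 = b \<and> K 2 = a)" "\<not> (K 1 = a \<and> K 2 = b \<and> K 3 = a)"
    "\<not> (K 2 = a \<and> K 3 = b \<and> K 0 = a)" "\<not> (K 3 = a \<and> K 0 = b \<and> K 1 = a)"
    if "a = 1 \<and> b = 2 \<or> a = 2 \<and> b = 1" for a b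
    using that K4 forbidden_121[OF c, of 0] forbidden_121[OF c, of 1] forbidden_121[OF c, of 2]
      forbidden_121[OF c, of 3] forbidden_212[OF c, of 0] forbidden_212[OF c, of 1]
      forbidden_212[OF c, of 2] forbidden_212[OF c, of 3]
    by (auto simp: eval_nat_numeral)
  consider "K 0 = 1" "K 1 = 1" "K 2 = 1" "K 3 = 1" | "K 0 = 2" "K 1 = 2" "K 2 = 2" "K 3 = 2"
    | "K 0 = 1" "K 1 = 2" "K 2 = 2" "K 3 = 1" | "K 0 = 2" "K 1 = 2" "K 2 = 1" "K 3 = 1"
    | "K 0 = 2" "K 1 = 1" "K 2 = 1" "K 3 = 2" | "K 0 = 1" "K 1 = 1" "K 2 = 2" "K 3 = 2"
    using no[of 1 2] no[of 2 1] K_cases[OF c, of 0] K_cases[OF c, of 1] K_cases[OF c, of 2]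
      K_cases[OF c, of 3] by metis
  then show ?thesis
  proof cases
    case 1
    then have "z = (1 - 1 / sqrt 2, 1 - 1 / sqrt 2)"
      using X01 by (simp add: z_eq half)
    then show ?thesis by simp
  next
    case 2
    then have "z = (2 - sqrt 2, 2 - sqrt 2)"
      using X01 by (simp add: z_eq)
    then show ?thesis by simp
  next
    case 3
    then have "z = (Tmap ^^ 0) (3 / 2 - sqrt 2, 3 / 2 - sqrt 2)"
      using X01 by (simp add: z_eq)
    then show ?thesis by (intro disjI2 bexI[of _ 0]) auto
  next
    case 4
    then have "z = (Tmap ^^ 1) (3 / 2 - sqrt 2, 3 / 2 - sqrt 2)"
      using X01 orbit_4(2) by (simp add: z_eq)
    then show ?thesis by (intro disjI2 bexI[of _ 1]) auto
  next
    case 5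
    then have "z = (Tmap ^^ 2) (3 / 2 - sqrt 2, 3 / 2 - sqrt 2)"
      using X01 orbit_4(3) by (simp add: z_eq)
    then show ?thesis by (intro disjI2 bexI[of _ 2]) auto
  next
    case 6
    then have "z = (Tmap ^^ 3) (3 / 2 - sqrt 2, 3 / 2 - sqrt 2)"
      using X01 orbit_4(4) by (simp add: z_eq)
    then show ?thesis by (intro disjI2 bexI[of _ 3]) auto
  qed
qed simp

section \<open>The classification\<close>

lemma period_funpow: "z \<in> unit_sq \<Longrightarrow> period ((Tmap ^^ n) z) = period z"
  by (simp add: period_eq_orb_weight T.funpow_in T.orb_weight_funpow)

lemma period_eqI:
  assumes "z \<in> unit_sq" "(Tmap ^^ p) z = z" "p > 0"
    and "\<And>q. prime q \<Longrightarrow> q dvd p \<Longrightarrow> (Tmap ^^ (p div q)) z \<noteq> z"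
  shows "period z = enat p"
proof -
  have "(Tmap ^^ d) z \<noteq> z" if "0 < d" "d < p" for d
    using minimal_period_criterion[OF assms(2,3,4) that] .
  then have "orb_weight Tmap (\<lambda>_. 1) z = enat (\<Sum>j<p. 1)"
    using assms by (intro T.orb_weight_periodic) auto
  then show ?thesis
    using assms by (simp add: period_eq_orb_weight)
qed

lemma period_fixed_points:
  assumes "z \<in> {(0, 0), (1 - 1 / sqrt 2, 1 - 1 / sqrt 2), (2 - sqrt 2, 2 - sqrt 2)}"
  shows "period z = 1"
proof -
  have half: "1 / sqrt 2 = sqrt 2 / 2"
    by (simp add: field_simps)
  have "z \<in> unit_sq \<and> Tmap z = z"
    using assms
  proof (elim insertE emptyE)
    assume z: "z = (1 - 1 / sqrt 2, 1 - 1 / sqrt 2)"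
    have "Tmap (1 - sqrt 2 / 2, 1 - sqrt 2 / 2) = (1 - sqrt 2 / 2, 1 - sqrt 2 / 2)"
      using sqrt2_bounds by (intro Tmap_eqI[of _ _ _ 1]) (auto simp: algebra_simps)
    then show ?thesis
      using sqrt2_bounds unfolding z half unit_sq_def by simp
  next
    assume z: "z = (2 - sqrt 2, 2 - sqrt 2)"
    have "Tmap (2 - sqrt 2, 2 - sqrt 2) = (2 - sqrt 2, 2 - sqrt 2)"
      using sqrt2_bounds by (intro Tmap_eqI[of _ _ _ 2]) (auto simp: algebra_simps)
    then show ?thesis
      using sqrt2_bounds unfolding z unit_sq_def by simp
  qed (auto simp: unit_sq_def Tmap_def)
  then show ?thesis
    using period_eqI[of z 1] by (auto simp: one_enat_def)
qed

lemma period_orbit_4: "period ((Tmap ^^ m) (3 / 2 - sqrt 2, 3 / 2 - sqrt 2)) = 4"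
proof -
  define p where "p = (3 / 2 - sqrt 2, 3 / 2 - sqrt 2)"
  note orbit = orbit_4[folded p_def]
  have "period p = enat 4"
  proof (rule period_eqI)
    fix q :: nat assume "prime q" "q dvd 4"
    then have "q = 2"
      using prime_dvd_power[of q 2 2] primes_dvd_imp_eq[of q 2] by auto
    then show "(Tmap ^^ (4 div q)) p \<noteq> p"
      using orbit(3) by (simp add: p_def)
  qed (use orbit in auto)
  then show ?thesis
    using period_funpow[OF orbit(1)] unfolding p_def[symmetric] by (simp add: numeral_eq_enat)
qed

lemma period_orbit_10: "period ((Tmap ^^ m) (1 / sqrt 2, 0)) = 10"
proof -
  define p where "p = (1 / sqrt 2, 0 :: real)"
  note orbit = orbit_10[folded p_def]
  have "period p = enat 10"
  proof (rule period_eqI)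
    fix q :: nat assume "prime q" "q dvd 10"
    then have "q = 2 \<or> q = 5"
      using prime_dvd_mult_iff[of q 2 5] primes_dvd_imp_eq[of q 2] primes_dvd_imp_eq[of q 5] by auto
    moreover have "(Tmap ^^ 5) p \<noteq> p" "(Tmap ^^ 2) p \<noteq> p"
      unfolding orbit using sqrt2_bounds by (auto simp: p_def)
    ultimately show "(Tmap ^^ (10 div q)) p \<noteq> p"
      by auto
  qed (use orbit in auto)
  then show ?thesis
    using period_funpow[OF orbit(1)] unfolding p_def[symmetric] by (simp add: numeral_eq_enat)
qed

lemma period_Rset_8:
  assumes z: "z \<in> Rset"
    and "z \<notin> {(0, 0), (1 - 1 / sqrt 2, 1 - 1 / sqrt 2), (2 - sqrt 2, 2 - sqrt 2)}"
    and "\<not> (\<exists>m\<in>{0..3}. z = (Tmap ^^ m) (3 / 2 - sqrt 2, 3 / 2 - sqrt 2))"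
    and "\<not> (\<exists>m\<in>{0..9}. z = (Tmap ^^ m) (1 / sqrt 2, 0))"
  shows "period z = 8"
proof -
  have "period z = enat 8"
  proof (rule period_eqI)
    show "(Tmap ^^ 8) z = z"
      using Rset_period_8_or_orbit_10[OF z] assms(4) by blast
    show "z \<in> unit_sq"
      using z by (simp add: Rset_def)
    fix q :: nat assume "prime q" "q dvd 8"
    then have "q = 2"
      using prime_dvd_power[of q 2 3] primes_dvd_imp_eq[of q 2] by auto
    then show "(Tmap ^^ (8 div q)) z \<noteq> z"
      using Rset_period_4[OF z] assms(2,3) by auto
  qed simp
  then show ?thesis by (simp add: numeral_eq_enat)
qed

lemma level_time_cycles:
  "level_time n Above = nat (2 * 3 ^ (n + 1) - 5 * (- 1) ^ n)"
  "8 * level_time n Above = nat (8 * (2 * 3 ^ (n + 1) - 5 * (- 1) ^ n))"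
  "5 * level_time n Above + level_time n On = nat (4 * (3 ^ (n + 2) + 5 - 5 * (- 1) ^ n))"
  "2 * (5 * level_time n Above + level_time n On) = nat (8 * (3 ^ (n + 2) + 5 - 5 * (- 1) ^ n))"
  "2 * level_time n Above + level_time n On = nat (2 * 3 ^ (n + 2) + 20 - 5 * (- 1) ^ n)"
  using level_time(1,3)[of n] by auto

lemma centre_in_Dalpha: "(3 - 3 / sqrt 2, 3 - 3 / sqrt 2) \<in> Dalpha"
proof (rule always_above_imp_Dalpha)
  define c where "c = 3 - 3 / 2 * sqrt 2"
  have c: "3 - 3 / sqrt 2 = c"
    by (simp add: c_def field_simps)
  have sum: "c + sqrt 2 * c > 2" and "3 - c - sqrt 2 * c = c"
    using sqrt2_bounds by (simp_all add: c_def algebra_simps sqrt2_mult)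
  then have fixed: "(c, c) \<in> Dset" "That (c, c) = (c, c)"
  proof -
    show "(c, c) \<in> Dset"
      unfolding Dset_iff using sum sqrt2_bounds by (auto simp: c_def)
    then show "That (c, c) = (c, c)"
      using That_above sum \<open>3 - c - sqrt 2 * c = c\<close> by simp
  qed
  show "(3 - 3 / sqrt 2, 3 - 3 / sqrt 2) \<in> Dset"
    using fixed c by simp
  have "(That ^^ n) (c, c) = (c, c)" for n
    by (induction n) (simp_all add: fixed)
  then show "part ((That ^^ n) (3 - 3 / sqrt 2, 3 - 3 / sqrt 2)) = Above" for n
    using sum by (simp add: c part_def)
qed

lemma midpoint_orbit:
  defines "p \<equiv> ((3 - sqrt 2) / 2, 2 - sqrt 2 * ((3 - sqrt 2) / 2))"
  shows "p \<in> Dbeta" "(That ^^ 2) p = ((9 - 5 * sqrt 2) / 2, 5 - 3 * sqrt 2)"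
proof -
  have mid: "5 - 3 * sqrt 2 < (3 - sqrt 2) / 2" "(3 - sqrt 2) / 2 < 2 * sqrt 2 - 2"
    using sqrt2_bounds by (auto simp: field_simps)
  then show "p \<in> Dbeta"
    unfolding p_def by (rule Dbeta_memI)
  show "(That ^^ 2) p = ((9 - 5 * sqrt 2) / 2, 5 - 3 * sqrt 2)"
    unfolding p_def Dbeta_orbit(3)[OF mid] by (simp add: field_simps)
qed

lemma orb_weight_midpoint_orbit:
  "orb_weight That (\<lambda>u. h (part u)) ((That ^^ m) ((9 - 5 * sqrt 2) / 2, 5 - 3 * sqrt 2))
    = enat (5 * h Above + h On)"
proof -
  define p where "p = ((3 - sqrt 2) / 2, 2 - sqrt 2 * ((3 - sqrt 2) / 2))"
  note p = midpoint_orbit[folded p_def]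
  have "p \<in> Dset"
    using p(1) Dbeta_subset by auto
  then have "orb_weight That (\<lambda>u. h (part u)) ((That ^^ m) ((That ^^ 2) p)) = orb_weight That (\<lambda>u. h (part u)) p"
    by (simp add: That.orb_weight_funpow That.funpow_in)
  also have "\<dots> = enat (5 * h Above + h On)"
    by (rule orb_weight_Dbeta(1)[OF p(1)]) (simp add: p_def)
  finally show ?thesis
    unfolding p(2) .
qed

text \<open>The given centre is the second iterate of the midpoint and the cycle has length 6, which explains
  the shift of the exponent by \<open>4 = 6 - 2\<close>.\<close>

lemma midpoint_in_centre_orbit:
  assumes "p \<in> Dbeta" "fst p = (3 - sqrt 2) / 2" "m \<in> {0..5}"
  shows "\<exists>j\<in>{0..5}. (That ^^ m) p = (That ^^ j) ((9 - 5 * sqrt 2) / 2, 5 - 3 * sqrt 2)"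
proof -
  have p: "p = ((3 - sqrt 2) / 2, 2 - sqrt 2 * ((3 - sqrt 2) / 2))"
    using assms(1,2) by (auto simp: Dbeta_def)
  have "fst ((That ^^ 6) p) = fst p"
    using That6_Dbeta(2)[OF assms(1)] assms(2) by (simp add: field_simps)
  then have six: "(That ^^ 6) p = p"
    using That6_Dbeta(1)[OF assms(1)] assms(1) by (auto simp: Dbeta_def)
  have "(That ^^ m) p = (That ^^ ((m + 4) mod 6 + 2)) p"
  proof -
    have "(That ^^ m) p = (That ^^ (m mod 6)) p"
      unfolding funpow_mod_eq[OF six] ..
    also have "m mod 6 = ((m + 4) mod 6 + 2) mod 6"
      by (simp add: mod_simps)
    finally show ?thesis
      unfolding funpow_mod_eq[OF six] .
  qed
  also have "\<dots> = (That ^^ ((m + 4) mod 6)) ((9 - 5 * sqrt 2) / 2, 5 - 3 * sqrt 2)"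
    unfolding funpow_add using midpoint_orbit(2) by (simp add: p)
  finally show ?thesis
    using mod_less_divisor[of 6 "m + 4"] by (intro bexI[of _ "(m + 4) mod 6"]) auto
qed

theorem theorem6p1:
  fixes z :: "real \<times> real" and s :: "real \<times> real \<Rightarrow> int"
  assumes "z \<in> unit_sq" and "admissible s"
  defines "E1 \<equiv> {(0, 0), (1 - 1 / sqrt 2, 1 - 1 / sqrt 2), (2 - sqrt 2, 2 - sqrt 2)}"
    and "E4 \<equiv> {(Tmap ^^ m) (3 / 2 - sqrt 2, 3 / 2 - sqrt 2) | m. m \<in> {0..3}}"
    and "E10 \<equiv> {(Tmap ^^ m) (1 / sqrt 2, 0) | m. m \<in> {0..9}}"
    and "cA \<equiv> (3 - 3 / sqrt 2, 3 - 3 / sqrt 2)"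
    and "CB \<equiv> {(That ^^ m) ((9 - 5 * sqrt 2) / 2, 5 - 3 * sqrt 2) | m. m \<in> {0..5}}"
    and "BB \<equiv> (\<Union>m\<in>{0..5}. (That ^^ m) ` Dbeta)"
    and "CC \<equiv> {(That ^^ m) (8 - 5 * sqrt 2, 8 - 5 * sqrt 2) | m. m \<in> {0..2}}"
  shows
    "(z \<in> E1 \<longrightarrow> period z = 1) \<and>
     (z \<in> E4 \<longrightarrow> period z = 4) \<and>
     (z \<in> E10 \<longrightarrow> period z = 10) \<and>
     (z \<in> Rset - (E1 \<union> E4 \<union> E10) \<longrightarrow> period z = 8) \<and>
     (\<forall>n w. SnR s n z = Some w \<longrightarrow>
        (w = cA \<longrightarrow> period z = enat (nat (2 * 3 ^ (n + 1) - 5 * (- 1) ^ n))) \<and>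
        (w \<in> Dalpha - {cA} \<longrightarrow> period z = enat (nat (8 * (2 * 3 ^ (n + 1) - 5 * (- 1) ^ n)))) \<and>
        (w \<in> CB \<longrightarrow> period z = enat (nat (4 * (3 ^ (n + 2) + 5 - 5 * (- 1) ^ n)))) \<and>
        (w \<in> BB - CB \<longrightarrow> period z = enat (nat (8 * (3 ^ (n + 2) + 5 - 5 * (- 1) ^ n)))) \<and>
        (w \<in> CC \<longrightarrow> period z = enat (nat (2 * 3 ^ (n + 2) + 20 - 5 * (- 1) ^ n)))) \<and>
     ((\<forall>n. \<exists>w. SnR s n z = Some w \<and> w \<in> Dset - Pset) \<longrightarrow> period z = \<infinity>) \<and>
     (z \<in> E1 \<union> E4 \<union> E10 \<union> Rset \<or>
      (\<exists>n w. SnR s n z = Some w \<and> w \<in> {cA} \<union> Dalpha \<union> CB \<union> BB \<union> CC) \<or>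
      (\<forall>n. \<exists>w. SnR s n z = Some w \<and> w \<in> Dset - Pset))"
proof -
  have time: "period z = orb_weight That (\<lambda>u. level_time n (part u)) w" "w \<in> Dset"
    if "SnR s n z = Some w" for n w
    using SnR_weight[OF assms(1,2) that] by auto
  have E4_iff: "z \<in> E4 \<longleftrightarrow> (\<exists>m\<in>{0..3}. z = (Tmap ^^ m) (3 / 2 - sqrt 2, 3 / 2 - sqrt 2))"
    and E10_iff: "z \<in> E10 \<longleftrightarrow> (\<exists>m\<in>{0..9}. z = (Tmap ^^ m) (1 / sqrt 2, 0))"
    by (auto simp: E4_def E10_def)
  have 1: "z \<in> E1 \<longrightarrow> period z = 1"
    unfolding E1_def using period_fixed_points by blast
  have 2: "z \<in> E4 \<longrightarrow> period z = 4"
    unfolding E4_iff using period_orbit_4 by auto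
  have 3: "z \<in> E10 \<longrightarrow> period z = 10"
    unfolding E10_iff using period_orbit_10 by auto
  have 4: "z \<in> Rset - (E1 \<union> E4 \<union> E10) \<longrightarrow> period z = 8"
    using period_Rset_8[of z] unfolding E1_def[symmetric] E4_iff[symmetric] E10_iff[symmetric] by blast
  have 5: "\<forall>n w. SnR s n z = Some w \<longrightarrow>
        (w = cA \<longrightarrow> period z = enat (nat (2 * 3 ^ (n + 1) - 5 * (- 1) ^ n))) \<and>
        (w \<in> Dalpha - {cA} \<longrightarrow> period z = enat (nat (8 * (2 * 3 ^ (n + 1) - 5 * (- 1) ^ n)))) \<and>
        (w \<in> CB \<longrightarrow> period z = enat (nat (4 * (3 ^ (n + 2) + 5 - 5 * (- 1) ^ n)))) \<and>
        (w \<in> BB - CB \<longrightarrow> period z = enat (nat (8 * (3 ^ (n + 2) + 5 - 5 * (- 1) ^ n)))) \<and>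
        (w \<in> CC \<longrightarrow> period z = enat (nat (2 * 3 ^ (n + 2) + 20 - 5 * (- 1) ^ n)))"
  proof (intro allI impI conjI)
    fix n w
    assume "SnR s n z = Some w"
    note t = time[OF this] and cyc = level_time_cycles[of n, symmetric]
    show "period z = enat (nat (2 * 3 ^ (n + 1) - 5 * (- 1) ^ n))" if "w = cA"
      unfolding t(1) cyc using orb_weight_Dalpha(1)[OF centre_in_Dalpha] that by (simp add: cA_def)
    show "period z = enat (nat (8 * (2 * 3 ^ (n + 1) - 5 * (- 1) ^ n)))" if "w \<in> Dalpha - {cA}"
      unfolding t(1) cyc using orb_weight_Dalpha(2)[of w] that by (simp add: cA_def)
    show "period z = enat (nat (4 * (3 ^ (n + 2) + 5 - 5 * (- 1) ^ n)))" if "w \<in> CB"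
      unfolding t(1) cyc using that orb_weight_midpoint_orbit by (auto simp: CB_def)
    show "period z = enat (nat (8 * (3 ^ (n + 2) + 5 - 5 * (- 1) ^ n)))" if w: "w \<in> BB - CB"
    proof -
      obtain m p where p: "m \<in> {0..5}" "p \<in> Dbeta" "w = (That ^^ m) p"
        using w unfolding BB_def by blast
      then have "fst p \<noteq> (3 - sqrt 2) / 2"
        using midpoint_in_centre_orbit[of p m] w by (auto simp: CB_def)
      moreover have "p \<in> Dset"
        using p Dbeta_subset by auto
      ultimately show ?thesis
        unfolding t(1) cyc p(3) using orb_weight_Dbeta(2)[OF p(2)]
        by (simp add: That.orb_weight_funpow)
    qed
    show "period z = enat (nat (2 * 3 ^ (n + 2) + 20 - 5 * (- 1) ^ n))" if "w \<in> CC"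
      unfolding t(1) cyc using that exceptional_orbit(1,5)
      by (auto simp: CC_def That.orb_weight_funpow)
  qed
  have 6: "(\<forall>n. \<exists>w. SnR s n z = Some w \<and> w \<in> Dset - Pset) \<longrightarrow> period z = \<infinity>"
    using period_infinite[OF assms(1,2)] by blast
  have 7: "z \<in> E1 \<union> E4 \<union> E10 \<union> Rset \<or>
      (\<exists>n w. SnR s n z = Some w \<and> w \<in> {cA} \<union> Dalpha \<union> CB \<union> BB \<union> CC) \<or>
      (\<forall>n. \<exists>w. SnR s n z = Some w \<and> w \<in> Dset - Pset)"
  proof (cases "z \<in> Rset \<or> (\<exists>n w. SnR s n z = Some w \<and> w \<in> Pset)")
    case True
    moreover have "w \<in> Dalpha \<union> BB \<union> CC" if "w \<in> Pset" for w
      using Pset_subset[OF that] unfolding BB_def CC_def by blast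
    ultimately show ?thesis by blast
  next
    case False
    have "\<exists>w. SnR s n z = Some w \<and> w \<in> Dset - Pset" for n
    proof (induction n)
      case 0
      have "SnR s 0 z = Some (Rmap z)"
        using False assms(1) by simp
      then show ?case
        using False time(2) by blast
    next
      case (Suc n)
      then obtain w where w: "SnR s n z = Some w" "w \<in> Dset - Pset" by blast
      then have "SnR s (Suc n) z = Some (Smap s w)"
        by simp
      then show ?case
        using False time(2) by blast
    qed
    then show ?thesis by blast
  qed
  show ?thesis
    using 1 2 3 4 5 6 7 by (intro conjI)
qed

end
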